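(* Let $N\ge 1$, let $\Omega\subset\mathbb{R}^N$ be a bounded domain, and let $p,q>0$ satisfy $\frac{1}{p+1}+\frac{1}{q+1}>\frac{N-2}{N}$ and $pq>1$. Let $s>1$ be such that the embeddings $W^{1,s}_0(\Omega)\hookrightarrow L^{p+1}(\Omega)$ and $W^{1,\frac{s}{s-1}}_0(\Omega)\hookrightarrow L^{q+1}(\Omega)$ are continuous and compact. Define $\mathcal G_s: W^{1,s}_0(\Omega)\times W^{1,\frac{s}{s-1}}_0(\Omega)\to\mathbb{R}$ by $$\mathcal G_s(u,v)=\int_\Omega \langle\nabla u,\nabla v\rangle\,dx-\int_\Omega\left(\frac{|u|^{p+1}}{p+1}+\frac{|v|^{q+1}}{q+1}\right)dx$$ and the Nehari set $$\mathcal N_{\mathcal G_s}=\{(u,v)\in W^{1,s}_0(\Omega)\times W^{1,\frac{s}{s-1}}_0(\Omega):\ (u,v)\neq(0,0),\ \mathcal G_s'(u,v)(u,v)=0\}.$$ Then $(0,0)$ is an adherent point of $\mathcal N_{\mathcal G_s}$ (i.e. it belongs to the closure of $\mathcal N_{\mathcal G_s}$) and $\inf_{\mathcal N_{\mathcal G_s}}\mathcal G_s\le 0$.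
   Context: $\langle\cdot,\cdot\rangle$ is the canonical inner product of $\mathbb{R}^N$. The functional $\mathcal G_s$ is of class $C^1$, with $\mathcal G_s'(u,v)(\varphi,\psi)=\int_\Omega(\langle\nabla u,\nabla\psi\rangle+\langle\nabla v,\nabla\varphi\rangle-|u|^{p-1}u\varphi-|v|^{q-1}v\psi)\,dx$. Under the stated hypotheses on $(p,q)$ an exponent $s>1$ with the required embeddings exists. *)

theory Defs
  imports "HOL-Analysis.Analysis" "HOL-Library.Function_Algebras"
begin

text \<open>
  Elements of Lebesgue and Sobolev spaces on \<open>\<Omega>\<close> are represented by functions on the whole ambient
  space, of which only the values on \<open>\<Omega>\<close> up to null sets matter. Consequently all the norms below
  are seminorms on function spaces, and equality of two elements means equality almost everywhere
  on \<open>\<Omega>\<close>. The pointwise vector space structure is used on functions, the componentwise one on pairs.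
\<close>

instantiation "fun" :: (type, real_vector) real_vector
begin

definition scaleR_fun :: "real \<Rightarrow> ('a \<Rightarrow> 'b) \<Rightarrow> 'a \<Rightarrow> 'b" where
  "scaleR_fun c f = (\<lambda>x. c *\<^sub>R f x)"

instance
  by standard (simp_all add: scaleR_fun_def fun_eq_iff algebra_simps)

end

subsection \<open>Lebesgue spaces\<close>

definition Lp :: "'a measure \<Rightarrow> real \<Rightarrow> ('a \<Rightarrow> 'b::euclidean_space) set" where
  "Lp M r = {f \<in> borel_measurable M. integrable M (\<lambda>x. norm (f x) powr r)}"

definition Lp_norm :: "'a measure \<Rightarrow> real \<Rightarrow> ('a \<Rightarrow> 'b::euclidean_space) \<Rightarrow> real" where
  "Lp_norm M r f = (\<integral>x. norm (f x) powr r \<partial>M) powr (1 / r)"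

subsection \<open>Sobolev spaces\<close>

primrec C_k :: "nat \<Rightarrow> ('a::euclidean_space \<Rightarrow> real) \<Rightarrow> bool" where
  "C_k 0 f \<longleftrightarrow> continuous_on UNIV f"
| "C_k (Suc k) f \<longleftrightarrow>
     (\<forall>x. f differentiable (at x)) \<and> (\<forall>b\<in>Basis. C_k k (\<lambda>x. frechet_derivative f (at x) b))"

definition test_functions :: "'a::euclidean_space set \<Rightarrow> ('a \<Rightarrow> real) set" where
  "test_functions \<Omega> = {\<phi>. (\<forall>k. C_k k \<phi>) \<and> compact (closure {x. \<phi> x \<noteq> 0}) \<and>
     closure {x. \<phi> x \<noteq> 0} \<subseteq> \<Omega>}"

definition locally_integrable :: "'a::euclidean_space set \<Rightarrow> ('a \<Rightarrow> 'b::euclidean_space) \<Rightarrow> bool" where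
  "locally_integrable \<Omega> f \<longleftrightarrow> (\<forall>K. compact K \<and> K \<subseteq> \<Omega> \<longrightarrow> integrable (lebesgue_on K) f)"

definition is_weak_gradient ::
  "'a::euclidean_space set \<Rightarrow> ('a \<Rightarrow> real) \<Rightarrow> ('a \<Rightarrow> 'a) \<Rightarrow> bool" where
  "is_weak_gradient \<Omega> u g \<longleftrightarrow> locally_integrable \<Omega> u \<and> locally_integrable \<Omega> g \<and>
     (\<forall>\<phi>\<in>test_functions \<Omega>. \<forall>b\<in>Basis.
        (\<integral>x. u x * frechet_derivative \<phi> (at x) b \<partial>lebesgue_on \<Omega>) =
        - (\<integral>x. (g x \<bullet> b) * \<phi> x \<partial>lebesgue_on \<Omega>))"

text \<open>On an open \<open>\<Omega>\<close> a weak gradient is unique up to null sets, so the choice is immaterial below.\<close>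

definition weak_grad :: "'a::euclidean_space set \<Rightarrow> ('a \<Rightarrow> real) \<Rightarrow> 'a \<Rightarrow> 'a" where
  "weak_grad \<Omega> u = (SOME g. is_weak_gradient \<Omega> u g)"

definition W1 :: "'a::euclidean_space set \<Rightarrow> real \<Rightarrow> ('a \<Rightarrow> real) set" where
  "W1 \<Omega> s = {u \<in> Lp (lebesgue_on \<Omega>) s. \<exists>g\<in>Lp (lebesgue_on \<Omega>) s. is_weak_gradient \<Omega> u g}"

definition W1_norm :: "'a::euclidean_space set \<Rightarrow> real \<Rightarrow> ('a \<Rightarrow> real) \<Rightarrow> real" where
  "W1_norm \<Omega> s u = Lp_norm (lebesgue_on \<Omega>) s u + Lp_norm (lebesgue_on \<Omega>) s (weak_grad \<Omega> u)"

text \<open>The closure of the test functions in \<open>W1 \<Omega> s\<close>.\<close>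

definition W1_0 :: "'a::euclidean_space set \<Rightarrow> real \<Rightarrow> ('a \<Rightarrow> real) set" where
  "W1_0 \<Omega> s = {u \<in> W1 \<Omega> s. \<exists>\<phi>. (\<forall>n. \<phi> n \<in> test_functions \<Omega>) \<and>
     (\<lambda>n. W1_norm \<Omega> s (u - \<phi> n)) \<longlonglongrightarrow> 0}"

subsection \<open>Embeddings\<close>

definition continuous_embedding :: "'a::euclidean_space set \<Rightarrow> real \<Rightarrow> real \<Rightarrow> bool" where
  "continuous_embedding \<Omega> s r \<longleftrightarrow> W1_0 \<Omega> s \<subseteq> Lp (lebesgue_on \<Omega>) r \<and>
     (\<exists>C. \<forall>u\<in>W1_0 \<Omega> s. Lp_norm (lebesgue_on \<Omega>) r u \<le> C * W1_norm \<Omega> s u)"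

definition compact_embedding :: "'a::euclidean_space set \<Rightarrow> real \<Rightarrow> real \<Rightarrow> bool" where
  "compact_embedding \<Omega> s r \<longleftrightarrow> W1_0 \<Omega> s \<subseteq> Lp (lebesgue_on \<Omega>) r \<and>
     (\<forall>u :: nat \<Rightarrow> 'a \<Rightarrow> real. (\<forall>n. u n \<in> W1_0 \<Omega> s) \<and> (\<exists>B. \<forall>n. W1_norm \<Omega> s (u n) \<le> B) \<longrightarrow>
        (\<exists>f\<in>Lp (lebesgue_on \<Omega>) r. \<exists>k. strict_mono k \<and>
           (\<lambda>n. Lp_norm (lebesgue_on \<Omega>) r (u (k n) - f)) \<longlonglongrightarrow> 0))"

subsection \<open>Derivatives and closures in a seminormed subspace\<close>

text \<open>
  \<open>F\<close> is Frechet differentiable at \<open>w\<close> with derivative \<open>D\<close>, as a functional on the linear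
  subspace \<open>V\<close> with the seminorm \<open>nrm\<close>. The library notion \<open>has_derivative\<close> does not apply, since
  \<open>V\<close> depends on \<open>\<Omega>\<close> and \<open>s\<close> and hence is not a type.
\<close>

definition has_frechet_derivative_on ::
  "'v::real_vector set \<Rightarrow> ('v \<Rightarrow> real) \<Rightarrow> ('v \<Rightarrow> real) \<Rightarrow> 'v \<Rightarrow> ('v \<Rightarrow> real) \<Rightarrow> bool" where
  "has_frechet_derivative_on V nrm F w D \<longleftrightarrow>
     (\<forall>h\<in>V. \<forall>k\<in>V. D (h + k) = D h + D k) \<and>
     (\<forall>c. \<forall>h\<in>V. D (c *\<^sub>R h) = c * D h) \<and>
     (\<exists>C. \<forall>h\<in>V. \<bar>D h\<bar> \<le> C * nrm h) \<and>
     (\<forall>\<epsilon>>0. \<exists>\<delta>>0. \<forall>h\<in>V. nrm h < \<delta> \<longrightarrow> \<bar>F (w + h) - F w - D h\<bar> \<le> \<epsilon> * nrm h)"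

definition closure_on :: "'v::real_vector set \<Rightarrow> ('v \<Rightarrow> real) \<Rightarrow> 'v set \<Rightarrow> 'v set" where
  "closure_on V nrm A = {w \<in> V. \<forall>\<epsilon>>0. \<exists>z\<in>A. nrm (z - w) < \<epsilon>}"

subsection \<open>The functional and its Nehari set\<close>

definition X_space ::
  "'a::euclidean_space set \<Rightarrow> real \<Rightarrow> (('a \<Rightarrow> real) \<times> ('a \<Rightarrow> real)) set" where
  "X_space \<Omega> s = W1_0 \<Omega> s \<times> W1_0 \<Omega> (s / (s - 1))"

definition X_norm ::
  "'a::euclidean_space set \<Rightarrow> real \<Rightarrow> ('a \<Rightarrow> real) \<times> ('a \<Rightarrow> real) \<Rightarrow> real" where
  "X_norm \<Omega> s = (\<lambda>(u, v). W1_norm \<Omega> s u + W1_norm \<Omega> (s / (s - 1)) v)"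

text \<open>The exponent \<open>s\<close> enters only through the domain \<open>X_space \<Omega> s\<close> of the functional.\<close>

definition G_functional ::
  "'a::euclidean_space set \<Rightarrow> real \<Rightarrow> real \<Rightarrow> ('a \<Rightarrow> real) \<times> ('a \<Rightarrow> real) \<Rightarrow> real" where
  "G_functional \<Omega> p q = (\<lambda>(u, v).
     (\<integral>x. weak_grad \<Omega> u x \<bullet> weak_grad \<Omega> v x \<partial>lebesgue_on \<Omega>) -
     (\<integral>x. (\<bar>u x\<bar> powr (p + 1) / (p + 1) + \<bar>v x\<bar> powr (q + 1) / (q + 1)) \<partial>lebesgue_on \<Omega>))"

definition nehari ::
  "'a::euclidean_space set \<Rightarrow> real \<Rightarrow> real \<Rightarrow> real \<Rightarrow> (('a \<Rightarrow> real) \<times> ('a \<Rightarrow> real)) set" where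
  "nehari \<Omega> s p q = {(u, v) \<in> X_space \<Omega> s.
     \<not> (AE x in lebesgue_on \<Omega>. u x = 0 \<and> v x = 0) \<and>
     (\<exists>D. has_frechet_derivative_on (X_space \<Omega> s) (X_norm \<Omega> s) (G_functional \<Omega> p q) (u, v) D \<and>
          D (u, v) = 0)}"

end

theory Submission
  imports Defs "HOL-Computational_Algebra.Polynomial"
begin

text \<open>
  Fix one test function \<open>\<phi> \<noteq> 0\<close> on \<open>\<Omega>\<close> and look for Nehari points of the form \<open>(a \<phi>, c \<phi>)\<close>
  with \<open>a, c > 0\<close>. Put \<open>D = \<integral>|\<nabla>\<phi>|\<^sup>2\<close>, \<open>A = \<integral>|\<phi>|\<^sup>p\<^sup>+\<^sup>1\<close> and \<open>B = \<integral>|\<phi>|\<^sup>q\<^sup>+\<^sup>1\<close>, all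
  positive. The Nehari equation becomes \<open>2 a c D = a\<^sup>p\<^sup>+\<^sup>1 A + c\<^sup>q\<^sup>+\<^sup>1 B\<close>. Substituting \<open>c = \<kappa> a\<^sup>p\<close> and
  dividing by \<open>a\<^sup>p\<^sup>+\<^sup>1\<close> leaves
    \<open>2 \<kappa> D = A + \<kappa>\<^sup>q\<^sup>+\<^sup>1 a\<^sup>p\<^sup>q\<^sup>-\<^sup>1 B\<close>.
  As \<open>p q > 1\<close>, this has a solution \<open>a > 0\<close> for every \<open>\<kappa> > A / (2 D)\<close>, and \<open>a\<close> tends to \<open>0\<close> when
  \<open>\<kappa>\<close> decreases to \<open>A / (2 D)\<close>. So the Nehari set contains a curve running into the origin. Along
  this curve the functional is at most its quadratic part \<open>a c D\<close>, which tends to \<open>0\<close>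
  (\<open>small_nehari_point\<close>).

  What needs work is that such points really belong to the Nehari set, whose definition asks for a
  Frechet derivative of the functional at \<open>(u, v)\<close> on the Sobolev spaces
  (\<open>G_functional_has_frechet_derivative\<close>). Differentiability is proved at pairs of test functions
  only, where it is easier because the base point is bounded. The quadratic part is bilinear and
  bounded by Hoelder's inequality. The power terms are expanded pointwise, uniformly over bounded base
  points (\<open>abs_powr_remainder\<close>), and the remainder is absorbed by the continuous embeddings.

  The functional involves a weak gradient picked by choice, so even its bilinearity rests on the
  uniqueness of weak gradients up to null sets. That is the fundamental lemma of the calculus of
  variations. It is obtained from smooth bumps that approximate indicators of boxes, together with a
  Dynkin system argument. The classical gradient of a test function is a weak gradient because
  directional derivatives of compactly supported functions integrate to zero
  (\<open>integral_directional_derivative_eq_0\<close>).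
\<close>

section \<open>Smooth bump functions\<close>

lemma C_k_imp_continuous: "C_k k f \<Longrightarrow> continuous_on UNIV f"
  by (cases k) (auto intro!: continuous_at_imp_continuous_on differentiable_imp_continuous_within)

lemma C_k_SucD: "C_k (Suc k) f \<Longrightarrow> C_k k f"
proof (induction k arbitrary: f)
  case 0
  then show ?case using C_k_imp_continuous[of "Suc 0" f] by simp
qed auto

lemma C_k_Suc_has_derivativeI:
  assumes "\<And>x. (f has_derivative f' x) (at x)" "\<And>b. b \<in> Basis \<Longrightarrow> C_k k (\<lambda>x. f' x b)"
  shows "C_k (Suc k) f"
proof -
  have "frechet_derivative f (at x) = f' x" for x
    using frechet_derivative_at[OF assms(1)] by simp
  then show ?thesis
    using assms by (auto simp: differentiable_def)
qed

lemma C_k_const: "C_k k (\<lambda>x. c)"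
  by (induction k arbitrary: c) auto

lemma C_k_add:
  assumes "C_k k f" "C_k k g"
  shows "C_k k (\<lambda>x. f x + g x)"
  using assms
proof (induction k arbitrary: f g)
  case 0
  then show ?case by (auto intro: continuous_intros)
next
  case (Suc k)
  show ?case
  proof (rule C_k_Suc_has_derivativeI)
    show "((\<lambda>x. f x + g x) has_derivative
      (\<lambda>b. frechet_derivative f (at x) b + frechet_derivative g (at x) b)) (at x)" for x
      using Suc.prems by (intro has_derivative_add) (auto simp flip: frechet_derivative_works)
  qed (use Suc in auto)
qed

lemma C_k_mult:
  assumes "C_k k f" "C_k k g"
  shows "C_k k (\<lambda>x. f x * g x)"
  using assms
proof (induction k arbitrary: f g)
  case 0
  then show ?case by (auto intro: continuous_intros)
next
  case (Suc k)
  show ?case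
  proof (rule C_k_Suc_has_derivativeI)
    show "((\<lambda>x. f x * g x) has_derivative
      (\<lambda>b. f x * frechet_derivative g (at x) b + frechet_derivative f (at x) b * g x)) (at x)" for x
      using Suc.prems by (intro has_derivative_mult) (auto simp flip: frechet_derivative_works)
    show "C_k k (\<lambda>x. f x * frechet_derivative g (at x) b + frechet_derivative f (at x) b * g x)"
      if "b \<in> Basis" for b
      using Suc.prems[THEN C_k_SucD] Suc.prems that by (intro C_k_add Suc.IH) auto
  qed
qed

lemma C_k_prod:
  assumes "\<And>i. i \<in> I \<Longrightarrow> C_k k (f i)"
  shows "C_k k (\<lambda>x. \<Prod>i\<in>I. f i x)"
  using assms
proof (induction I rule: infinite_finite_induct)
  case (insert i I)
  have "C_k k (\<lambda>x. f i x * (\<Prod>i\<in>I. f i x))"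
    by (rule C_k_mult) (use insert in auto)
  with insert show ?case by simp
qed (simp_all add: C_k_const)

text \<open>The functions \<open>P(1/t) exp(-1/t)\<close>, extended by zero to \<open>t \<le> 0\<close>. Letting the polynomial vary makes
  the family closed under differentiation, so that smoothness needs only first derivatives.\<close>

definition flat_exp :: "real poly \<Rightarrow> real \<Rightarrow> real" where
  "flat_exp P t = (if t > 0 then poly P (1 / t) * exp (- (1 / t)) else 0)"

lemma poly_exp_tendsto_0: "((\<lambda>y::real. poly P y * exp (- y)) \<longlongrightarrow> 0) at_top"
proof -
  have "((\<lambda>y. \<Sum>i\<le>degree P. coeff P i * (y ^ i / exp y)) \<longlongrightarrow> (\<Sum>i\<le>degree P. coeff P i * 0)) at_top"
    by (intro tendsto_sum tendsto_mult tendsto_const tendsto_power_div_exp_0)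
  then show ?thesis
    by (simp add: poly_altdef sum_distrib_left exp_minus divide_inverse mult_ac)
qed

lemma flat_exp_tendsto_0: "(flat_exp P \<longlongrightarrow> 0) (at 0)"
proof -
  have "((\<lambda>t. poly P (inverse t) * exp (- inverse t)) \<longlongrightarrow> 0) (at_right 0)"
    by (rule filterlim_compose[OF poly_exp_tendsto_0 filterlim_inverse_at_top_right])
  moreover have "\<forall>\<^sub>F t in at_right 0. poly P (inverse t) * exp (- inverse t) = flat_exp P t"
    by (auto simp: eventually_at_filter flat_exp_def divide_inverse)
  ultimately have r: "(flat_exp P \<longlongrightarrow> 0) (at_right 0)"
    using Lim_transform_eventually by fast
  have "\<forall>\<^sub>F t in at_left 0. 0 = flat_exp P t"
    by (auto simp: eventually_at_filter flat_exp_def)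
  then have "(flat_exp P \<longlongrightarrow> 0) (at_left 0)"
    using Lim_transform_eventually tendsto_const by fast
  with r show ?thesis
    by (simp add: filterlim_split_at)
qed

lemma DERIV_flat_exp:
  "(flat_exp P has_real_derivative flat_exp (monom 1 2 * (P - pderiv P)) t) (at t)"
proof -
  consider "t > 0" | "t < 0" | "t = 0" by linarith
  then show ?thesis
  proof cases
    case 1
    have "((\<lambda>t. poly P (1 / t) * exp (- (1 / t))) has_real_derivative
        flat_exp (monom 1 2 * (P - pderiv P)) t) (at t)"
      using 1 by (auto intro!: derivative_eq_intros simp: flat_exp_def poly_monom field_simps
          power2_eq_square)
    then show ?thesis
      by (rule has_field_derivative_transform_within_open[where S = "{0<..}"])
        (use 1 in \<open>auto simp: flat_exp_def\<close>)
  next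
    case 2
    have "((\<lambda>t. 0) has_real_derivative flat_exp (monom 1 2 * (P - pderiv P)) t) (at t)"
      using 2 by (auto simp: flat_exp_def)
    then show ?thesis
      by (rule has_field_derivative_transform_within_open[where S = "{..<0}"])
        (use 2 in \<open>auto simp: flat_exp_def\<close>)
  next
    case 3
    \<comment> \<open>The difference quotient at \<open>0\<close> is itself in the family, with the polynomial multiplied by \<open>1/t\<close>.\<close>
    have "\<forall>\<^sub>F h in at 0. flat_exp (pCons 0 P) h = (flat_exp P (0 + h) - flat_exp P 0) / h"
      by (auto simp: eventually_at_filter flat_exp_def)
    then have "((\<lambda>h. (flat_exp P (0 + h) - flat_exp P 0) / h) \<longlongrightarrow> 0) (at 0)"
      using Lim_transform_eventually flat_exp_tendsto_0 by fast
    then show ?thesis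
      using 3 by (simp add: DERIV_def flat_exp_def)
  qed
qed

lemma C_k_flat_exp_affine: "C_k k (\<lambda>x::'a::euclidean_space. flat_exp P (\<alpha> * (x \<bullet> e) + \<beta>))"
proof (induction k arbitrary: P)
  case 0
  have "continuous_on UNIV (flat_exp P)"
    by (meson DERIV_flat_exp DERIV_isCont continuous_at_imp_continuous_on)
  then show ?case
    unfolding C_k.simps by (rule continuous_on_compose2) (intro continuous_intros, simp)
next
  case (Suc k)
  show ?case
  proof (rule C_k_Suc_has_derivativeI)
    fix x :: 'a
    show "((\<lambda>x. flat_exp P (\<alpha> * (x \<bullet> e) + \<beta>)) has_derivative
      (\<lambda>b. (\<alpha> * (b \<bullet> e)) * flat_exp (monom 1 2 * (P - pderiv P)) (\<alpha> * (x \<bullet> e) + \<beta>))) (at x)"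
      by (rule DERIV_compose_FDERIV[OF DERIV_flat_exp]) (auto intro!: derivative_eq_intros)
  qed (intro C_k_mult C_k_const Suc.IH)
qed

text \<open>Smooth functions positive exactly on an open box; they tend to the indicator of the box as
  \<open>n\<close> grows, since \<open>exp (-1/(n t))\<close> tends to \<open>1\<close> for \<open>t > 0\<close>.\<close>

definition box_bump :: "'a::euclidean_space \<Rightarrow> 'a \<Rightarrow> nat \<Rightarrow> 'a \<Rightarrow> real" where
  "box_bump a c n x = (\<Prod>b\<in>Basis. flat_exp 1 (real (Suc n) * (x \<bullet> b - a \<bullet> b)) *
     flat_exp 1 (real (Suc n) * (c \<bullet> b - x \<bullet> b)))"

lemma flat_exp_1_bounds: "0 \<le> flat_exp 1 t" "flat_exp 1 t \<le> 1" "flat_exp 1 t = 0 \<longleftrightarrow> t \<le> 0"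
  by (auto simp: flat_exp_def)

lemma box_bump_nonneg: "0 \<le> box_bump a c n x"
  unfolding box_bump_def by (intro prod_nonneg mult_nonneg_nonneg ballI flat_exp_1_bounds)

lemma box_bump_le_1: "box_bump a c n x \<le> 1"
  unfolding box_bump_def
  by (intro prod_le_1 conjI mult_nonneg_nonneg mult_le_one flat_exp_1_bounds)

lemma box_bump_eq_0_iff: "box_bump a c n x = 0 \<longleftrightarrow> x \<notin> box a c"
  by (auto simp: box_bump_def flat_exp_1_bounds mem_box mult_le_0_iff not_less)

lemma C_k_box_bump: "C_k k (box_bump a c n)"
proof -
  have *: "C_k k (\<lambda>x. flat_exp 1 (real (Suc n) * (x \<bullet> b - a \<bullet> b)))" for b
    using C_k_flat_exp_affine[of k 1 "real (Suc n)" b "- real (Suc n) * (a \<bullet> b)"]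
    by (simp add: algebra_simps)
  have **: "C_k k (\<lambda>x. flat_exp 1 (real (Suc n) * (c \<bullet> b - x \<bullet> b)))" for b
    using C_k_flat_exp_affine[of k 1 "- real (Suc n)" b "real (Suc n) * (c \<bullet> b)"]
    by (simp add: algebra_simps)
  show ?thesis
    unfolding box_bump_def[abs_def] by (rule C_k_prod, rule C_k_mult[OF * **])
qed

lemma box_bump_in_test_functions:
  assumes "cbox a c \<subseteq> \<Omega>"
  shows "box_bump a c n \<in> test_functions \<Omega>"
proof -
  have "{x. box_bump a c n x \<noteq> 0} = box a c"
    by (simp add: box_bump_eq_0_iff)
  moreover have "closure (box a c) \<subseteq> cbox a c"
    by (intro closure_minimal box_subset_cbox closed_cbox)
  moreover have "compact (closure (box a c))"
    by (simp add: compact_closure)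
  ultimately show ?thesis
    using assms C_k_box_bump[of _ a c n] unfolding test_functions_def by auto
qed

lemma box_bump_tendsto_indicator: "(\<lambda>n. box_bump a c n x) \<longlonglongrightarrow> indicator (box a c) x"
proof (cases "x \<in> box a c")
  case True
  have *: "(\<lambda>n. flat_exp 1 (real (Suc n) * t)) \<longlonglongrightarrow> 1" if "t > 0" for t
  proof -
    have "(\<lambda>n. exp (- (1 / t * inverse (real (Suc n))))) \<longlonglongrightarrow> exp (- (1 / t * 0))"
      by (rule tendsto_exp, rule tendsto_minus, rule tendsto_mult_left,
          rule LIMSEQ_inverse_real_of_nat)
    moreover have "flat_exp 1 (real (Suc n) * t) = exp (- (1 / t * inverse (real (Suc n))))" for n
      using that by (simp add: flat_exp_def field_simps del: of_nat_Suc)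
    ultimately show ?thesis by simp
  qed
  have "(\<lambda>n. box_bump a c n x) \<longlonglongrightarrow> (\<Prod>b\<in>(Basis::'a set). 1 * 1)"
    unfolding box_bump_def by (rule tendsto_prod, rule tendsto_mult; rule *)
      (use True in \<open>auto simp: mem_box\<close>)
  with True show ?thesis by simp
next
  case False
  then show ?thesis by (simp add: box_bump_eq_0_iff[THEN iffD2])
qed

section \<open>Test functions and their gradients\<close>

lemma test_function_has_derivative:
  assumes "\<phi> \<in> test_functions \<Omega>"
  shows "(\<phi> has_derivative frechet_derivative \<phi> (at x)) (at x)"
proof -
  have "C_k (Suc 0) \<phi>" using assms unfolding test_functions_def by blast
  then show ?thesis by (simp add: frechet_derivative_works)
qed

lemma test_function_continuous: "\<phi> \<in> test_functions \<Omega> \<Longrightarrow> continuous_on UNIV \<phi>"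
  using C_k_imp_continuous unfolding test_functions_def by blast

lemma test_function_partial_continuous:
  assumes "\<phi> \<in> test_functions \<Omega>" "b \<in> Basis"
  shows "continuous_on UNIV (\<lambda>x. frechet_derivative \<phi> (at x) b)"
proof -
  have "C_k (Suc 0) \<phi>" using assms unfolding test_functions_def by blast
  with assms show ?thesis by simp
qed

definition grad :: "('a::euclidean_space \<Rightarrow> real) \<Rightarrow> 'a \<Rightarrow> 'a" where
  "grad f x = (\<Sum>b\<in>Basis. frechet_derivative f (at x) b *\<^sub>R b)"

lemma grad_inner_Basis: "b \<in> Basis \<Longrightarrow> grad f x \<bullet> b = frechet_derivative f (at x) b"
  by (simp add: grad_def inner_sum_left inner_Basis if_distrib cong: if_cong)

lemma grad_continuous: "\<phi> \<in> test_functions \<Omega> \<Longrightarrow> continuous_on UNIV (grad \<phi>)"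
  unfolding grad_def by (intro continuous_intros test_function_partial_continuous)

lemma derivative_eq_0_outside_support:
  assumes "x \<notin> closure {x. f x \<noteq> 0}"
  shows "frechet_derivative f (at x) = (\<lambda>b. 0)"
proof -
  have "(f has_derivative (\<lambda>b. 0)) (at x)"
    by (rule has_derivative_transform_within_open[where f = "\<lambda>x. 0" and s = "- closure {x. f x \<noteq> 0}"])
      (use assms closure_subset[of "{x. f x \<noteq> 0}"] in auto)
  then show ?thesis using frechet_derivative_at by metis
qed

lemma grad_eq_0_outside_support: "x \<notin> closure {x. f x \<noteq> 0} \<Longrightarrow> grad f x = 0"
  by (simp add: grad_def derivative_eq_0_outside_support)

lemma test_functions_scale:
  assumes "\<phi> \<in> test_functions \<Omega>"
  shows "(\<lambda>x. a * \<phi> x) \<in> test_functions \<Omega>"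
proof (cases "a = 0")
  case True
  then show ?thesis by (simp add: test_functions_def C_k_const)
next
  case False
  then have "{x. a * \<phi> x \<noteq> 0} = {x. \<phi> x \<noteq> 0}" by simp
  with assms C_k_mult[OF C_k_const, of _ \<phi> a] show ?thesis
    by (simp add: test_functions_def)
qed

lemma grad_scale:
  assumes "\<phi> \<in> test_functions \<Omega>"
  shows "grad (\<lambda>x. a * \<phi> x) x = a *\<^sub>R grad \<phi> x"
proof -
  have "((\<lambda>x. a * \<phi> x) has_derivative (\<lambda>h. a * frechet_derivative \<phi> (at x) h)) (at x)"
    using assms by (intro has_derivative_mult_right test_function_has_derivative)
  note frechet_derivative_at[OF this, symmetric]
  then show ?thesis
    by (simp add: grad_def scaleR_sum_right)
qed

lemma zero_in_test_functions: "(0 :: 'a::euclidean_space \<Rightarrow> real) \<in> test_functions \<Omega>"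
  by (simp add: test_functions_def zero_fun_def C_k_const)

lemma test_function_bounded:
  assumes "\<phi> \<in> test_functions \<Omega>"
  obtains M where "M \<ge> 0" "\<And>x. \<bar>\<phi> x\<bar> \<le> M" "\<And>x. norm (grad \<phi> x) \<le> M"
proof -
  let ?K = "closure {x. \<phi> x \<noteq> 0}"
  have K: "compact ?K" using assms by (auto simp: test_functions_def)
  have "bounded (\<phi> ` ?K)" "bounded (grad \<phi> ` ?K)"
    using K test_function_continuous[OF assms] grad_continuous[OF assms]
    by (auto intro!: compact_imp_bounded compact_continuous_image intro: continuous_on_subset)
  then obtain B1 B2 where B: "\<And>x. x \<in> ?K \<Longrightarrow> \<bar>\<phi> x\<bar> \<le> B1" "\<And>x. x \<in> ?K \<Longrightarrow> norm (grad \<phi> x) \<le> B2"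
    unfolding bounded_iff by force
  have out: "\<phi> x = 0" "grad \<phi> x = 0" if "x \<notin> ?K" for x
    using that closure_subset[of "{x. \<phi> x \<noteq> 0}"] grad_eq_0_outside_support by auto
  have "\<bar>\<phi> x\<bar> \<le> max 0 (max B1 B2)" "norm (grad \<phi> x) \<le> max 0 (max B1 B2)" for x
    using B[of x] out[of x] by (cases "x \<in> ?K"; force)+
  then show ?thesis using that[of "max 0 (max B1 B2)"] by simp
qed

section \<open>Integration by parts for test functions\<close>

lemma integrable_compact_support:
  fixes f :: "'a::euclidean_space \<Rightarrow> 'b::euclidean_space"
  assumes "continuous_on UNIV f" "compact K" "\<And>x. x \<notin> K \<Longrightarrow> f x = 0"
  shows "integrable lborel f"
proof -
  have "integrable lborel (\<lambda>x. indicator K x *\<^sub>R f x)"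
    by (rule borel_integrable_compact) (use assms in \<open>auto intro: continuous_on_subset\<close>)
  moreover have "(\<lambda>x. indicator K x *\<^sub>R f x) = f"
    using assms(3) by (auto simp: indicator_def fun_eq_iff)
  ultimately show ?thesis by simp
qed

lemma bounded_compact_support:
  fixes f :: "'a::euclidean_space \<Rightarrow> 'b::euclidean_space"
  assumes "continuous_on UNIV f" "compact K" "\<And>x. x \<notin> K \<Longrightarrow> f x = 0"
  obtains M where "M \<ge> 0" "\<And>x. norm (f x) \<le> M"
proof -
  have "bounded (f ` K)"
    using assms by (auto intro!: compact_imp_bounded compact_continuous_image intro: continuous_on_subset)
  then obtain B where B: "\<And>x. x \<in> K \<Longrightarrow> norm (f x) \<le> B"
    unfolding bounded_iff by force
  have "norm (f x) \<le> max 0 B" for x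
    using B[of x] assms(3)[of x] by (cases "x \<in> K") auto
  then show ?thesis using that[of "max 0 B"] by simp
qed

lemma lborel_integrable_translation:
  fixes f :: "'a::euclidean_space \<Rightarrow> 'b::euclidean_space"
  assumes "integrable lborel f"
  shows "integrable lborel (\<lambda>x. f (c + x))" and "(\<integral>x. f (c + x) \<partial>lborel) = (\<integral>x. f x \<partial>lborel)"
proof -
  have [measurable]: "f \<in> borel_measurable borel"
    using assms by auto
  show "integrable lborel (\<lambda>x. f (c + x))"
    using assms by (subst (asm) lborel_distr_plus[of c, symmetric], subst (asm) integrable_distr_eq) auto
  show "(\<integral>x. f (c + x) \<partial>lborel) = (\<integral>x. f x \<partial>lborel)"
    by (subst (2) lborel_distr_plus[of c, symmetric], subst integral_distr) auto
qed

text \<open>By translation invariance the difference quotients of \<open>f\<close> in direction \<open>b\<close> all have integral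
  zero, and they converge to the derivative boundedly with supports in a fixed ball.\<close>

lemma integral_directional_derivative_eq_0:
  fixes f :: "'a::euclidean_space \<Rightarrow> real"
  assumes df: "\<And>x. (f has_derivative f' x) (at x)" and cont: "continuous_on UNIV (\<lambda>x. f' x b)"
    and "compact K" and f0: "\<And>x. x \<notin> K \<Longrightarrow> f x = 0" and f'0: "\<And>x. x \<notin> K \<Longrightarrow> f' x b = 0"
  shows "(\<integral>x. f' x b \<partial>lborel) = 0"
proof -
  have contf: "continuous_on UNIV f"
    using df by (meson continuous_at_imp_continuous_on has_derivative_continuous)
  obtain M where M: "M \<ge> 0" "\<And>x. norm (f' x b) \<le> M"
    using bounded_compact_support[OF cont \<open>compact K\<close> f'0] by blast
  obtain R where R: "\<And>x. x \<in> K \<Longrightarrow> norm x \<le> R"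
    using compact_imp_bounded[OF \<open>compact K\<close>] unfolding bounded_iff by blast
  have line: "((\<lambda>t. f (x + t *\<^sub>R b)) has_real_derivative f' (x + t *\<^sub>R b) b) (at t)" for x t
  proof -
    have "((\<lambda>t. f (x + t *\<^sub>R b)) has_derivative (\<lambda>h. f' (x + t *\<^sub>R b) (h *\<^sub>R b))) (at t)"
      by (rule has_derivative_compose[OF _ df]) (auto intro!: derivative_eq_intros)
    then show ?thesis
      by (simp add: has_field_derivative_def mult.commute
          linear_scale[OF has_derivative_linear[OF df]])
         (simp add: mult_commute_abs)
  qed
  define s where "s n x = real (Suc n) * (f (inverse (real (Suc n)) *\<^sub>R b + x) - f x)" for n x
  define L where "L = cball (0::'a) (R + norm b)"
  have s_lim: "(\<lambda>n. s n x) \<longlonglongrightarrow> f' x b" for x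
  proof -
    have "((\<lambda>h. (f (x + h *\<^sub>R b) - f x) / h) \<longlongrightarrow> f' x b) (at 0)"
      using line[of x 0] by (simp add: DERIV_def)
    moreover have "filterlim (\<lambda>n. inverse (real (Suc n))) (at 0) sequentially"
      unfolding filterlim_at using LIMSEQ_inverse_real_of_nat by auto
    ultimately have "(\<lambda>n. (f (x + inverse (real (Suc n)) *\<^sub>R b) - f x) / inverse (real (Suc n))) \<longlonglongrightarrow> f' x b"
      by (rule filterlim_compose)
    then show ?thesis
      by (simp add: s_def[abs_def] divide_inverse add.commute mult.commute del: of_nat_Suc)
  qed
  have s_bound: "norm (s n x) \<le> M * indicator L x" for n x
  proof (cases "x \<in> L")
    case True
    let ?t = "inverse (real (Suc n))"
    have t: "0 < ?t" by simp
    obtain z where "f (x + ?t *\<^sub>R b) - f (x + 0 *\<^sub>R b) = (?t - 0) * f' (x + z *\<^sub>R b) b"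
      using MVT2[OF t, of "\<lambda>t. f (x + t *\<^sub>R b)" "\<lambda>t. f' (x + t *\<^sub>R b) b"] line by blast
    then have "s n x = f' (x + z *\<^sub>R b) b"
      by (simp add: s_def add.commute del: of_nat_Suc)
    with M True show ?thesis by simp
  next
    case False
    let ?t = "inverse (real (Suc n))"
    have "norm (?t *\<^sub>R b) \<le> norm b"
      by (simp add: field_simps mult_left_le_one_le)
    moreover have "norm x > R + norm b" using False by (simp add: L_def)
    ultimately have "\<not> norm x \<le> R" "\<not> norm (?t *\<^sub>R b + x) \<le> R"
      using norm_triangle_ineq4[of "?t *\<^sub>R b + x" "?t *\<^sub>R b"] norm_ge_zero[of b]
      unfolding add_diff_cancel_left' by linarith+
    then have "x \<notin> K" "?t *\<^sub>R b + x \<notin> K"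
      using R by blast+
    then show ?thesis using f0 M by (simp add: s_def)
  qed
  have int_f: "integrable lborel f"
    by (rule integrable_compact_support[OF contf \<open>compact K\<close> f0])
  have int_s: "integrable lborel (s n)" "(\<integral>x. s n x \<partial>lborel) = 0" for n
    unfolding s_def[abs_def] using int_f lborel_integrable_translation[OF int_f] by simp_all
  have "(\<lambda>n. \<integral>x. s n x \<partial>lborel) \<longlonglongrightarrow> (\<integral>x. f' x b \<partial>lborel)"
  proof (rule integral_dominated_convergence[where w = "\<lambda>x. M * indicator L x"])
    show "(\<lambda>x. f' x b) \<in> borel_measurable lborel"
      using cont by (simp add: borel_measurable_continuous_onI)
    show "integrable lborel (\<lambda>x. M * indicator L x)"
      by (intro integrable_mult_right integrable_real_indicator)
        (use emeasure_bounded_finite[OF bounded_cball, of 0 "R + norm b"] in \<open>auto simp: L_def\<close>)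
  qed (use int_s s_lim s_bound in auto)
  then show ?thesis
    using int_s(2) LIMSEQ_unique[OF _ tendsto_const] by fastforce
qed

lemma integral_lebesgue_on_eq_lborel:
  fixes F :: "'a::euclidean_space \<Rightarrow> 'b::euclidean_space"
  assumes "S \<in> sets borel" "F \<in> borel_measurable borel" "\<And>x. x \<notin> S \<Longrightarrow> F x = 0"
  shows "integral\<^sup>L (lebesgue_on S) F = integral\<^sup>L lborel F"
proof -
  have "(\<lambda>x. indicator S x *\<^sub>R F x) = F"
    using assms(3) by (auto simp: indicator_def fun_eq_iff)
  moreover have "S \<inter> space lebesgue \<in> sets lebesgue"
    using assms(1) by auto
  ultimately show ?thesis
    using assms(2) by (simp add: integral_restrict_space integral_completion)
qed

lemma locally_integrable_continuous:
  assumes "continuous_on UNIV f"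
  shows "locally_integrable \<Omega> f"
  unfolding locally_integrable_def
proof (intro allI impI)
  fix K assume K: "compact K \<and> K \<subseteq> \<Omega>"
  have "integrable lborel (\<lambda>x. indicator K x *\<^sub>R f x)"
    by (rule borel_integrable_compact) (use K assms in \<open>auto intro: continuous_on_subset\<close>)
  then have "integrable lebesgue (\<lambda>x. indicator K x *\<^sub>R f x)"
    by (simp add: integrable_completion)
  with K show "integrable (lebesgue_on K) f"
    by (simp add: integrable_restrict_space lmeasurable_compact fmeasurableD)
qed

text \<open>For a test function \<open>\<psi>\<close> the product \<open>\<phi> \<psi>\<close> has compact support in \<open>\<Omega>\<close>, so the product rule
  reduces the defining identity to the vanishing of the integral of a directional derivative.\<close>

lemma test_function_weak_gradient:
  assumes "open \<Omega>" and \<phi>: "\<phi> \<in> test_functions \<Omega>"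
  shows "is_weak_gradient \<Omega> \<phi> (grad \<phi>)"
  unfolding is_weak_gradient_def
proof (intro conjI ballI)
  show "locally_integrable \<Omega> \<phi>" "locally_integrable \<Omega> (grad \<phi>)"
    using \<phi> by (simp_all add: locally_integrable_continuous test_function_continuous grad_continuous)
next
  fix \<psi> b assume \<psi>: "\<psi> \<in> test_functions \<Omega>" and b: "b \<in> (Basis :: 'a set)"
  define K where "K = closure {x. \<psi> x \<noteq> 0}"
  let ?D = "\<lambda>f x. frechet_derivative f (at x) b"
  have K: "compact K" "K \<subseteq> \<Omega>" using \<psi> by (auto simp: test_functions_def K_def)
  have out: "\<psi> x = 0" "?D \<psi> x = 0" if "x \<notin> K" for x
    using that closure_subset[of "{x. \<psi> x \<noteq> 0}"]
    by (auto simp: derivative_eq_0_outside_support K_def)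
  have cont: "continuous_on UNIV \<phi>" "continuous_on UNIV \<psi>" "continuous_on UNIV (?D \<phi>)" "continuous_on UNIV (?D \<psi>)"
    using \<phi> \<psi> b by (simp_all add: test_function_continuous test_function_partial_continuous)
  have "(\<integral>x. \<phi> x * ?D \<psi> x + ?D \<phi> x * \<psi> x \<partial>lborel) = 0"
  proof (rule integral_directional_derivative_eq_0[where K = K and f = "\<lambda>x. \<phi> x * \<psi> x"])
    show "((\<lambda>x. \<phi> x * \<psi> x) has_derivative
      (\<lambda>b. \<phi> x * frechet_derivative \<psi> (at x) b + frechet_derivative \<phi> (at x) b * \<psi> x)) (at x)" for x
      using \<phi> \<psi> by (intro has_derivative_mult test_function_has_derivative)
    show "continuous_on UNIV (\<lambda>x. \<phi> x * ?D \<psi> x + ?D \<phi> x * \<psi> x)"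
      using cont by (intro continuous_intros)
  qed (use K out in simp_all)
  moreover have cont': "continuous_on UNIV (\<lambda>x. \<phi> x * ?D \<psi> x)" "continuous_on UNIV (\<lambda>x. ?D \<phi> x * \<psi> x)"
    using cont by (auto intro!: continuous_on_mult)
  moreover have "integrable lborel (\<lambda>x. \<phi> x * ?D \<psi> x)" "integrable lborel (\<lambda>x. ?D \<phi> x * \<psi> x)"
    by (rule integrable_compact_support[where K = K]; simp add: cont' K out)+
  moreover have "integral\<^sup>L (lebesgue_on \<Omega>) F = integral\<^sup>L lborel F"
    if F: "continuous_on UNIV F" "\<And>x. x \<notin> K \<Longrightarrow> F x = 0" for F :: "'a \<Rightarrow> real"
  proof (rule integral_lebesgue_on_eq_lborel)
    show "F \<in> borel_measurable borel"
      using F(1) by (rule borel_measurable_continuous_onI)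
    show "\<Omega> \<in> sets borel" "\<And>x. x \<notin> \<Omega> \<Longrightarrow> F x = 0"
      using assms(1) F(2) K by auto
  qed
  ultimately show "(\<integral>x. \<phi> x * ?D \<psi> x \<partial>lebesgue_on \<Omega>) = - (\<integral>x. (grad \<phi> x \<bullet> b) * \<psi> x \<partial>lebesgue_on \<Omega>)"
    using out b by (simp add: grad_inner_Basis)
qed

section \<open>Hoelder's inequality\<close>

text \<open>Integrate Young's inequality after normalising both factors to norm one. If one of the norms
  vanishes, so does that factor almost everywhere.\<close>

lemma Holder_real:
  fixes f g :: "'a \<Rightarrow> real"
  assumes "r > 1" and [measurable]: "f \<in> borel_measurable M" "g \<in> borel_measurable M"
    and f: "integrable M (\<lambda>x. \<bar>f x\<bar> powr r)" and g: "integrable M (\<lambda>x. \<bar>g x\<bar> powr (r / (r - 1)))"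
  shows "integrable M (\<lambda>x. \<bar>f x\<bar> * \<bar>g x\<bar>)" (is ?int)
    and "(\<integral>x. \<bar>f x\<bar> * \<bar>g x\<bar> \<partial>M) \<le> (\<integral>x. \<bar>f x\<bar> powr r \<partial>M) powr (1 / r) *
      (\<integral>x. \<bar>g x\<bar> powr (r / (r - 1)) \<partial>M) powr (1 / (r / (r - 1)))" (is ?ineq)
proof -
  define r' where "r' = r / (r - 1)"
  have r': "r' > 1" "1 / r + 1 / r' = 1" using \<open>r > 1\<close> by (auto simp: r'_def field_simps)
  have g: "integrable M (\<lambda>x. \<bar>g x\<bar> powr r')" using g by (simp add: r'_def)
  have young: "\<bar>f x\<bar> * \<bar>g x\<bar> \<le> \<bar>f x\<bar> powr r / r + \<bar>g x\<bar> powr r' / r'" for x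
    using \<open>r > 1\<close> r' by (intro Youngs_inequality) auto
  show ?int
    by (rule Bochner_Integration.integrable_bound[of _ "\<lambda>x. \<bar>f x\<bar> powr r / r + \<bar>g x\<bar> powr r' / r'"])
      (use f g young in \<open>auto intro!: AE_I2 order_trans[OF _ abs_ge_self]\<close>)
  define F G where "F = (\<integral>x. \<bar>f x\<bar> powr r \<partial>M)" and "G = (\<integral>x. \<bar>g x\<bar> powr r' \<partial>M)"
  have "F \<ge> 0" "G \<ge> 0" by (simp_all add: F_def G_def)
  have zero: "(\<integral>x. \<bar>f x\<bar> * \<bar>g x\<bar> \<partial>M) = 0" if "F = 0 \<or> G = 0"
  proof (rule integral_eq_zero_AE)
    from that show "AE x in M. \<bar>f x\<bar> * \<bar>g x\<bar> = 0"
    proof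
      assume "F = 0"
      then have "AE x in M. \<bar>f x\<bar> powr r = 0"
        using integral_nonneg_eq_0_iff_AE[OF f] by (simp add: F_def)
      then show ?thesis by eventually_elim simp
    next
      assume "G = 0"
      then have "AE x in M. \<bar>g x\<bar> powr r' = 0"
        using integral_nonneg_eq_0_iff_AE[OF g] by (simp add: G_def)
      then show ?thesis by eventually_elim simp
    qed
  qed
  have "(\<integral>x. \<bar>f x\<bar> * \<bar>g x\<bar> \<partial>M) \<le> F powr (1 / r) * G powr (1 / r')"
  proof (cases "F = 0 \<or> G = 0")
    case False
    with \<open>F \<ge> 0\<close> \<open>G \<ge> 0\<close> have pos: "F > 0" "G > 0" by auto
    let ?a = "F powr (1 / r)" and ?b = "G powr (1 / r')"
    have ab: "?a > 0" "?b > 0" "?a powr r = F" "?b powr r' = G"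
      using pos \<open>r > 1\<close> r' by (auto simp: powr_powr)
    have "(\<integral>x. (\<bar>f x\<bar> * \<bar>g x\<bar>) / (?a * ?b) \<partial>M) \<le> (\<integral>x. (\<bar>f x\<bar> powr r / F) / r + (\<bar>g x\<bar> powr r' / G) / r' \<partial>M)"
    proof (rule integral_mono)
      show "integrable M (\<lambda>x. (\<bar>f x\<bar> * \<bar>g x\<bar>) / (?a * ?b))" using \<open>?int\<close> by simp
      show "integrable M (\<lambda>x. (\<bar>f x\<bar> powr r / F) / r + (\<bar>g x\<bar> powr r' / G) / r')" using f g by simp
      fix x
      have "(\<bar>f x\<bar> / ?a) * (\<bar>g x\<bar> / ?b) \<le> (\<bar>f x\<bar> / ?a) powr r / r + (\<bar>g x\<bar> / ?b) powr r' / r'"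
        using \<open>r > 1\<close> r' by (intro Youngs_inequality) auto
      then show "(\<bar>f x\<bar> * \<bar>g x\<bar>) / (?a * ?b) \<le> (\<bar>f x\<bar> powr r / F) / r + (\<bar>g x\<bar> powr r' / G) / r'"
        using ab by (simp add: powr_divide)
    qed
    also have "\<dots> = (F / F) / r + (G / G) / r'"
      using f g by (simp add: F_def G_def)
    also have "\<dots> = 1" using pos r' by simp
    finally show ?thesis using ab by (simp add: field_simps)
  qed (simp add: zero)
  then show ?ineq by (simp add: F_def G_def r'_def)
qed

lemma Lp_norm_nonneg: "0 \<le> Lp_norm M r f"
  by (simp add: Lp_norm_def)

lemma Lp_norm_cong_AE:
  assumes "AE x in M. norm (f x) = norm (g x)"
    and [measurable]: "f \<in> borel_measurable M" "g \<in> borel_measurable M"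
  shows "Lp_norm M r f = Lp_norm M r g"
proof -
  have "(\<integral>x. norm (f x) powr r \<partial>M) = (\<integral>x. norm (g x) powr r \<partial>M)"
    by (rule integral_cong_AE) (use assms(1) in auto)
  then show ?thesis by (simp add: Lp_norm_def)
qed

lemma Lp_norm_powr: "r > 0 \<Longrightarrow> Lp_norm M r f powr r = (\<integral>x. norm (f x) powr r \<partial>M)"
  by (simp add: Lp_norm_def powr_powr)

lemma Holder_Lp:
  assumes "r > 1" "f \<in> Lp M r" "g \<in> Lp M (r / (r - 1))"
  shows "integrable M (\<lambda>x. norm (f x) * norm (g x))"
    and "(\<integral>x. norm (f x) * norm (g x) \<partial>M) \<le> Lp_norm M r f * Lp_norm M (r / (r - 1)) g"
  using Holder_real[of r "\<lambda>x. norm (f x)" M "\<lambda>x. norm (g x)"] assms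
  by (auto simp: Lp_def Lp_norm_def)

lemma Holder_inner:
  fixes f g :: "'a \<Rightarrow> 'b::euclidean_space"
  assumes "r > 1" "f \<in> Lp M r" "g \<in> Lp M (r / (r - 1))"
  shows "integrable M (\<lambda>x. f x \<bullet> g x)"
    and "\<bar>\<integral>x. f x \<bullet> g x \<partial>M\<bar> \<le> Lp_norm M r f * Lp_norm M (r / (r - 1)) g"
proof -
  have [measurable]: "f \<in> borel_measurable M" "g \<in> borel_measurable M"
    using assms by (auto simp: Lp_def)
  note H = Holder_Lp[OF assms]
  show int: "integrable M (\<lambda>x. f x \<bullet> g x)"
    by (rule Bochner_Integration.integrable_bound[OF H(1)]) (auto simp: Cauchy_Schwarz_ineq2)
  have "\<bar>\<integral>x. f x \<bullet> g x \<partial>M\<bar> \<le> (\<integral>x. \<bar>f x \<bullet> g x\<bar> \<partial>M)"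
    by (rule integral_abs_bound)
  also have "\<dots> \<le> (\<integral>x. norm (f x) * norm (g x) \<partial>M)"
    by (rule integral_mono) (use int H in \<open>auto simp: Cauchy_Schwarz_ineq2\<close>)
  finally show "\<bar>\<integral>x. f x \<bullet> g x \<partial>M\<bar> \<le> Lp_norm M r f * Lp_norm M (r / (r - 1)) g"
    using H(2) by linarith
qed

lemma (in finite_measure) bounded_in_Lp:
  assumes [measurable]: "f \<in> borel_measurable M" and "\<And>x. norm (f x) \<le> B" "r \<ge> 0"
  shows "f \<in> Lp M r"
proof -
  have "integrable M (\<lambda>x. norm (f x) powr r)"
    by (rule integrable_const_bound[where B = "B powr r"]) (use assms in \<open>auto intro!: powr_mono2\<close>)
  then show ?thesis by (simp add: Lp_def)
qed

lemma (in finite_measure) Lp_norm_le_of_bounded: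
  assumes "f \<in> borel_measurable M" "\<And>x. norm (f x) \<le> B" "r > 0"
  shows "Lp_norm M r f \<le> B * measure M (space M) powr (1 / r)"
proof -
  have B: "B \<ge> 0" using assms(2) norm_ge_zero order_trans by blast
  have int: "integrable M (\<lambda>x. norm (f x) powr r)"
    using bounded_in_Lp[of f B r] assms by (auto simp: Lp_def)
  have "(\<integral>x. norm (f x) powr r \<partial>M) \<le> (\<integral>x. B powr r \<partial>M)"
    by (rule integral_mono) (use assms int in \<open>auto intro!: powr_mono2\<close>)
  then have "Lp_norm M r f \<le> (measure M (space M) * B powr r) powr (1 / r)"
    unfolding Lp_norm_def using assms(3) by (intro powr_mono2) auto
  also have "\<dots> = B * measure M (space M) powr (1 / r)"
    using B assms(3) by (simp add: powr_mult powr_powr)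
  finally show ?thesis .
qed

text \<open>Hoelder's inequality against the constant \<open>1\<close>.\<close>

lemma (in finite_measure) Lp_imp_integrable:
  fixes f :: "'a \<Rightarrow> 'b::euclidean_space"
  assumes "r > 1" "f \<in> Lp M r"
  shows "integrable M f"
    and "(\<integral>x. norm (f x) \<partial>M) \<le> measure M (space M) powr (1 - 1 / r) * Lp_norm M r f"
proof -
  have one: "(\<lambda>x. 1 :: real) \<in> Lp M (r / (r - 1))"
    by (rule bounded_in_Lp[where B = 1]) (use assms in auto)
  note H = Holder_Lp[OF assms one]
  have "1 / (r / (r - 1)) = 1 - 1 / r" using assms(1) by (simp add: field_simps)
  then have "Lp_norm M (r / (r - 1)) (\<lambda>x. 1 :: real) = measure M (space M) powr (1 - 1 / r)"
    by (simp add: Lp_norm_def)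
  with H(2) show "(\<integral>x. norm (f x) \<partial>M) \<le> measure M (space M) powr (1 - 1 / r) * Lp_norm M r f"
    by (simp add: mult.commute)
  have "integrable M (\<lambda>x. norm (f x))" using H(1) by simp
  then show "integrable M f"
    using assms(2) by (simp add: Lp_def integrable_norm_iff)
qed

section \<open>First-order expansion of powers\<close>

text \<open>The derivative \<open>|t|\<^sup>p\<^sup>-\<^sup>1 t\<close> of \<open>|t|\<^sup>p\<^sup>+\<^sup>1/(p+1)\<close>.\<close>

definition odd_powr :: "real \<Rightarrow> real \<Rightarrow> real" where
  "odd_powr p t = sgn t * \<bar>t\<bar> powr p"

lemma abs_odd_powr: "\<bar>odd_powr p t\<bar> = \<bar>t\<bar> powr p"
  by (simp add: odd_powr_def abs_mult sgn_if)

lemma odd_powr_mult_self: "odd_powr p t * t = \<bar>t\<bar> powr (p + 1)"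
proof -
  have "odd_powr p t * t = \<bar>t\<bar> powr p * \<bar>t\<bar>"
    by (simp add: odd_powr_def sgn_if)
  then show ?thesis by (cases "t = 0") (simp_all add: powr_add)
qed

lemma odd_powr_conv: "odd_powr p t = max 0 t powr p - max 0 (- t) powr p"
  by (simp add: odd_powr_def sgn_if max_def)

lemma odd_powr_continuous:
  assumes "p > 0"
  shows "continuous_on S (odd_powr p)"
  unfolding odd_powr_conv[abs_def] using assms
  by (intro continuous_on_diff continuous_on_powr' continuous_intros) auto

lemma borel_measurable_odd_powr [measurable]: "odd_powr p \<in> borel_measurable borel"
  unfolding odd_powr_conv[abs_def] by measurable

lemma DERIV_abs_powr:
  assumes "p > 0"
  shows "((\<lambda>t. \<bar>t\<bar> powr (p + 1) / (p + 1)) has_real_derivative odd_powr p t) (at t)"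
proof -
  consider "t > 0" | "t < 0" | "t = 0" by linarith
  then show ?thesis
  proof cases
    case 1
    have "((\<lambda>t. t powr (p + 1) / (p + 1)) has_real_derivative odd_powr p t) (at t)"
      using 1 assms by (auto intro!: derivative_eq_intros simp: odd_powr_def)
    then show ?thesis
      by (rule has_field_derivative_transform_within_open[where S = "{0<..}"]) (use 1 in auto)
  next
    case 2
    have "((\<lambda>t. (- t) powr (p + 1) / (p + 1)) has_real_derivative odd_powr p t) (at t)"
      using 2 assms by (auto intro!: derivative_eq_intros simp: odd_powr_def)
    then show ?thesis
      by (rule has_field_derivative_transform_within_open[where S = "{..<0}"]) (use 2 in auto)
  next
    case 3
    have "isCont (odd_powr p) 0"
      using odd_powr_continuous[OF assms, of UNIV] by (simp add: continuous_on_eq_continuous_at)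
    then have "((\<lambda>h. odd_powr p h / (p + 1)) \<longlongrightarrow> odd_powr p 0 / (p + 1)) (at 0)"
      using assms by (intro tendsto_intros) (auto simp: isCont_def)
    then have "((\<lambda>h. odd_powr p h / (p + 1)) \<longlongrightarrow> 0) (at 0)"
      by (simp add: odd_powr_def)
    moreover have "\<forall>\<^sub>F h in at 0. odd_powr p h / (p + 1) = (\<bar>0 + h\<bar> powr (p + 1) / (p + 1) - \<bar>0\<bar> powr (p + 1) / (p + 1)) / h"
      by (auto simp: eventually_at_filter odd_powr_mult_self[symmetric])
    ultimately have "((\<lambda>h. (\<bar>0 + h\<bar> powr (p + 1) / (p + 1) - \<bar>0\<bar> powr (p + 1) / (p + 1)) / h) \<longlongrightarrow> 0) (at 0)"
      using Lim_transform_eventually by fast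
    with 3 show ?thesis by (simp add: DERIV_def odd_powr_def)
  qed
qed

text \<open>Small increments are handled by uniform continuity of the derivative, large ones by its growth.
  Only bounded base points \<open>a\<close> are considered, which makes the constants uniform.\<close>

lemma abs_powr_remainder:
  assumes "p > 0" "M \<ge> 0" "\<epsilon> > 0"
  obtains C where "C \<ge> 0" "\<And>a b. \<bar>a\<bar> \<le> M \<Longrightarrow>
    \<bar>\<bar>a + b\<bar> powr (p + 1) / (p + 1) - \<bar>a\<bar> powr (p + 1) / (p + 1) - odd_powr p a * b\<bar>
      \<le> \<epsilon> * \<bar>b\<bar> + C * \<bar>b\<bar> powr (p + 1)"
proof -
  have "uniformly_continuous_on {-(M+1)..M+1} (odd_powr p)"
    using odd_powr_continuous[OF assms(1)] by (intro compact_uniformly_continuous) auto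
  then obtain \<delta> where \<delta>: "\<delta> > 0"
    "\<And>x y. x \<in> {-(M+1)..M+1} \<Longrightarrow> y \<in> {-(M+1)..M+1} \<Longrightarrow> \<bar>y - x\<bar> < \<delta> \<Longrightarrow> \<bar>odd_powr p y - odd_powr p x\<bar> < \<epsilon>"
    using \<open>\<epsilon> > 0\<close> unfolding uniformly_continuous_on_def dist_real_def by metis
  \<comment> \<open>The bound \<open>1\<close> keeps \<open>a + z b\<close> inside the interval on which \<open>\<delta>\<close> was chosen.\<close>
  define \<eta> where "\<eta> = min (\<delta> / 2) 1"
  have \<eta>: "\<eta> > 0" "\<eta> < \<delta>" "\<eta> \<le> 1" using \<delta> by (auto simp: \<eta>_def)
  \<comment> \<open>For \<open>|b| > \<eta>\<close> both \<open>|a|\<close> and \<open>|a + z b|\<close> are at most \<open>(M / \<eta> + 1) |b|\<close>.\<close>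
  define C where "C = 2 * (M / \<eta> + 1) powr p"
  have "\<bar>\<bar>a + b\<bar> powr (p + 1) / (p + 1) - \<bar>a\<bar> powr (p + 1) / (p + 1) - odd_powr p a * b\<bar>
      \<le> \<epsilon> * \<bar>b\<bar> + C * \<bar>b\<bar> powr (p + 1)" if a: "\<bar>a\<bar> \<le> M" for a b
  proof -
    have D: "((\<lambda>t. \<bar>a + t * b\<bar> powr (p + 1) / (p + 1)) has_real_derivative odd_powr p (a + t * b) * b) (at t)" for t
      by (rule DERIV_chain2[OF DERIV_abs_powr[OF assms(1)]]) (auto intro!: derivative_eq_intros)
    obtain z where z: "0 < z" "z < 1" and
      eq: "\<bar>a + 1 * b\<bar> powr (p + 1) / (p + 1) - \<bar>a + 0 * b\<bar> powr (p + 1) / (p + 1) = (1 - 0) * (odd_powr p (a + z * b) * b)"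
      using MVT2[of 0 1 "\<lambda>t. \<bar>a + t * b\<bar> powr (p + 1) / (p + 1)" "\<lambda>t. odd_powr p (a + t * b) * b"] D by auto
    have zb: "\<bar>z * b\<bar> \<le> \<bar>b\<bar>"
      using z by (simp add: abs_mult mult_left_le_one_le)
    have rem: "\<bar>\<bar>a + b\<bar> powr (p + 1) / (p + 1) - \<bar>a\<bar> powr (p + 1) / (p + 1) - odd_powr p a * b\<bar>
        = \<bar>odd_powr p (a + z * b) - odd_powr p a\<bar> * \<bar>b\<bar>"
      using eq by (simp add: abs_mult[symmetric] left_diff_distrib)
    show ?thesis
    proof (cases "\<bar>b\<bar> \<le> \<eta>")
      case True
      have "\<bar>odd_powr p (a + z * b) - odd_powr p a\<bar> < \<epsilon>"
        by (rule \<delta>(2)) (use a zb True \<eta> in \<open>auto simp: abs_le_iff\<close>)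
      then have "\<bar>odd_powr p (a + z * b) - odd_powr p a\<bar> * \<bar>b\<bar> \<le> \<epsilon> * \<bar>b\<bar>"
        by (intro mult_right_mono) auto
      moreover have "0 \<le> C * \<bar>b\<bar> powr (p + 1)" by (simp add: C_def)
      ultimately show ?thesis using rem by linarith
    next
      case False
      then have b: "\<bar>b\<bar> > \<eta>" by simp
      have "M \<le> M / \<eta> * \<bar>b\<bar>"
        using b \<eta> \<open>M \<ge> 0\<close> mult_left_mono[of \<eta> "\<bar>b\<bar>" M] by (simp add: field_simps)
      then have M: "M + \<bar>b\<bar> \<le> (M / \<eta> + 1) * \<bar>b\<bar>" by (simp add: algebra_simps)
      have "\<bar>odd_powr p (a + z * b) - odd_powr p a\<bar> \<le> \<bar>a + z * b\<bar> powr p + \<bar>a\<bar> powr p"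
        using abs_triangle_ineq4[of "odd_powr p (a + z * b)" "odd_powr p a"] by (simp add: abs_odd_powr)
      also have "\<dots> \<le> ((M / \<eta> + 1) * \<bar>b\<bar>) powr p + ((M / \<eta> + 1) * \<bar>b\<bar>) powr p"
        using a zb M assms(1) by (intro add_mono powr_mono2) auto
      also have "\<dots> = C * \<bar>b\<bar> powr p"
        using \<eta> \<open>M \<ge> 0\<close> by (simp add: C_def powr_mult)
      finally have "\<bar>odd_powr p (a + z * b) - odd_powr p a\<bar> * \<bar>b\<bar> \<le> C * \<bar>b\<bar> powr p * \<bar>b\<bar>"
        by (intro mult_right_mono) auto
      also have "\<dots> = C * \<bar>b\<bar> powr (p + 1)"
        using b \<eta> by (simp add: powr_add)
      finally show ?thesis using rem \<open>\<epsilon> > 0\<close> by (simp add: add_increasing)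
    qed
  qed
  moreover have "C \<ge> 0" by (simp add: C_def)
  ultimately show ?thesis using that by blast
qed

section \<open>The fundamental lemma of the calculus of variations\<close>

text \<open>Local integrability gives measurability only on compact subsets; an open set is a countable union
  of these.\<close>

lemma locally_integrable_imp_measurable:
  fixes f :: "'a::euclidean_space \<Rightarrow> 'b::euclidean_space"
  assumes "open \<Omega>" "locally_integrable \<Omega> f"
  shows "f \<in> borel_measurable (lebesgue_on \<Omega>)"
proof -
  obtain C :: "nat \<Rightarrow> 'a set" where C: "\<And>n. compact (C n)" "\<And>n. C n \<subseteq> \<Omega>" "\<Union>(range C) = \<Omega>"
    by (rule open_Union_compact_subsets[OF \<open>open \<Omega>\<close>]) blast
  show ?thesis
  proof (rule measurable_piecewise_restrict[where C = "range C"])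
    show "S \<inter> space (lebesgue_on \<Omega>) \<in> sets (lebesgue_on \<Omega>)" if "S \<in> range C" for S
      using that C by (auto simp: sets_restrict_space intro!: image_eqI[where x = S]
          intro: lmeasurable_compact fmeasurableD)
    show "f \<in> borel_measurable (restrict_space (lebesgue_on \<Omega>) S)" if "S \<in> range C" for S
    proof -
      have "integrable (lebesgue_on S) f"
        using that C assms(2) unfolding locally_integrable_def by blast
      moreover have "S \<in> sets lebesgue" "\<Omega> \<in> sets lebesgue" "\<Omega> \<inter> S = S"
        using that C \<open>open \<Omega>\<close> by (auto intro: lmeasurable_compact fmeasurableD)
      then have "restrict_space (lebesgue_on \<Omega>) S = lebesgue_on S"
        by (subst restrict_restrict_space) auto
      ultimately show ?thesis by auto
    qed
    show "countable (range C)" by simp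
    show "space (lebesgue_on \<Omega>) \<subseteq> \<Union> (range C)" using C(3) by simp
  qed
qed

lemma continuous_imp_measurable_lebesgue_on:
  "continuous_on UNIV f \<Longrightarrow> f \<in> borel_measurable (lebesgue_on S)"
  by (intro measurable_restrict_space1 measurable_completion) (simp add: borel_measurable_continuous_onI)

lemma locally_integrable_indicator:
  fixes f :: "'a::euclidean_space \<Rightarrow> 'b::euclidean_space"
  assumes "open \<Omega>" "locally_integrable \<Omega> f" "compact K" "K \<subseteq> \<Omega>"
  shows "integrable (lebesgue_on \<Omega>) (\<lambda>x. indicator K x *\<^sub>R f x)"
proof -
  have "integrable (lebesgue_on K) f"
    using assms unfolding locally_integrable_def by blast
  then have "integrable lebesgue (\<lambda>x. indicator K x *\<^sub>R f x)"
    using assms by (simp add: integrable_restrict_space lmeasurable_compact fmeasurableD)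
  moreover have "(\<lambda>x. indicator \<Omega> x *\<^sub>R indicator K x *\<^sub>R f x) = (\<lambda>x. indicator K x *\<^sub>R f x)"
    using assms by (auto simp: indicator_def fun_eq_iff)
  ultimately show ?thesis
    using assms by (simp add: integrable_restrict_space)
qed

lemma locally_integrable_mult_compact_support:
  fixes f :: "'a::euclidean_space \<Rightarrow> 'b::euclidean_space"
  assumes "open \<Omega>" "locally_integrable \<Omega> f" "compact K" "K \<subseteq> \<Omega>"
    and \<psi>: "continuous_on UNIV \<psi>" "\<And>x. x \<notin> K \<Longrightarrow> \<psi> x = 0"
  shows "integrable (lebesgue_on \<Omega>) (\<lambda>x. \<psi> x *\<^sub>R f x)"
proof -
  obtain M where M: "M \<ge> 0" "\<And>x. norm (\<psi> x) \<le> M"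
    using bounded_compact_support[OF \<psi>(1) \<open>compact K\<close> \<psi>(2)] by blast
  have [measurable]: "f \<in> borel_measurable (lebesgue_on \<Omega>)"
    by (rule locally_integrable_imp_measurable) fact+
  have [measurable]: "\<psi> \<in> borel_measurable (lebesgue_on \<Omega>)"
    using \<psi>(1) by (rule continuous_imp_measurable_lebesgue_on)
  show ?thesis
  proof (rule Bochner_Integration.integrable_bound)
    show "integrable (lebesgue_on \<Omega>) (\<lambda>x. M *\<^sub>R (indicator K x *\<^sub>R f x))"
      using locally_integrable_indicator[OF assms(1-4)] by (rule integrable_scaleR_right)
    have "norm (\<psi> x *\<^sub>R f x) \<le> norm (M *\<^sub>R (indicator K x *\<^sub>R f x))" for x
      using M \<psi>(2)[of x] by (auto simp: indicator_def intro!: mult_right_mono)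
    then show "AE x in lebesgue_on \<Omega>. norm (\<psi> x *\<^sub>R f x) \<le> norm (M *\<^sub>R (indicator K x *\<^sub>R f x))"
      by simp
  qed measurable
qed

text \<open>The Borel sets on which the integral of \<open>f\<close> vanishes form a Dynkin system, and open boxes are an
  intersection-stable generator.\<close>

lemma AE_eq_0_if_box_integrals_eq_0:
  fixes f :: "'a::euclidean_space \<Rightarrow> real"
  assumes f: "integrable lborel f" "(\<integral>x. f x \<partial>lborel) = 0"
    and box: "\<And>a b. (LINT x:box a b|lborel. f x) = 0"
  shows "AE x in lborel. f x = 0"
proof (rule sigma_finite_measure.density_zero[OF sigma_finite_lborel f(1)])
  fix A :: "'a set" assume "A \<in> sets lborel"
  then have "A \<in> sets borel" by simp
  then have A: "A \<in> sigma_sets UNIV (range (\<lambda>(a, b). box a b))"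
    by (subst (asm) borel_eq_box) (simp add: sets_measure_of)
  have borel: "B \<in> sets borel" if "B \<in> sigma_sets UNIV (range (\<lambda>(a, b). box a b))" for B :: "'a set"
    using that by (subst borel_eq_box) (simp add: sets_measure_of)
  have int: "set_integrable lborel B f" if "B \<in> sets borel" for B
    unfolding set_integrable_def using that f(1) by (intro integrable_mult_indicator) auto
  have "Int_stable (range (\<lambda>(a, b). box a b :: 'a set))"
    by (auto simp: Int_stable_def box_Int_box)
  moreover have "range (\<lambda>(a, b). box a b :: 'a set) \<subseteq> Pow UNIV"
    by simp
  ultimately show "(LINT x:A|lborel. f x) = 0"
    using A
  proof (induction A rule: sigma_sets_induct_disjoint)
    case (compl B)
    have "(LINT x:UNIV - B|lborel. f x) = (\<integral>x. f x - indicator B x *\<^sub>R f x \<partial>lborel)"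
      unfolding set_lebesgue_integral_def
      by (rule Bochner_Integration.integral_cong) (auto simp: indicator_def)
    also have "\<dots> = (\<integral>x. f x \<partial>lborel) - (LINT x:B|lborel. f x)"
      using int[OF borel[OF compl(1)]] f(1) unfolding set_lebesgue_integral_def set_integrable_def
      by (intro Bochner_Integration.integral_diff) auto
    finally show ?case using compl(2) f(2) by simp
  next
    case (union B)
    have "(LINT x:(\<Union>i. B i)|lborel. f x) = (\<Sum>i. (LINT x:(B i)|lborel. f x))"
    proof (rule lebesgue_integral_countable_add)
      have "B i \<in> sets borel" for i
        using union(2) borel by blast
      then show "B i \<in> sets lborel" "set_integrable lborel (\<Union>i. B i) f" for i
        by (auto intro: int)
      show "B i \<inter> B j = {}" if "i \<noteq> j" for i j
        using union(1) that by (auto simp: disjoint_family_on_def)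
    qed
    with union(3) show ?case by simp
  next
    case empty
    then show ?case by (simp add: set_lebesgue_integral_def)
  qed (auto simp: box)
qed

text \<open>Testing against bumps that tend to the indicator of a box shows that \<open>f\<close> integrates to zero over
  every box in \<open>\<Omega>\<close>.\<close>

lemma box_integral_eq_0:
  fixes f :: "'a::euclidean_space \<Rightarrow> real"
  assumes "open \<Omega>" and f: "locally_integrable \<Omega> f"
    and test: "\<And>\<phi>. \<phi> \<in> test_functions \<Omega> \<Longrightarrow> (\<integral>x. f x * \<phi> x \<partial>lebesgue_on \<Omega>) = 0"
    and sub: "cbox a c \<subseteq> \<Omega>"
  shows "(\<integral>x. indicator (box a c) x * f x \<partial>lebesgue) = 0"
proof -
  have [measurable]: "f \<in> borel_measurable (lebesgue_on \<Omega>)"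
    by (rule locally_integrable_imp_measurable) fact+
  have meas: "(\<lambda>x. box_bump a c n x) \<in> borel_measurable (lebesgue_on \<Omega>)" for n
    using C_k_imp_continuous[OF C_k_box_bump] by (rule continuous_imp_measurable_lebesgue_on)
  have "(\<lambda>n. \<integral>x. f x * box_bump a c n x \<partial>lebesgue_on \<Omega>) \<longlonglongrightarrow> (\<integral>x. f x * indicator (box a c) x \<partial>lebesgue_on \<Omega>)"
  proof (rule integral_dominated_convergence[where w = "\<lambda>x. norm (indicator (cbox a c) x *\<^sub>R f x)"])
    show "integrable (lebesgue_on \<Omega>) (\<lambda>x. norm (indicator (cbox a c) x *\<^sub>R f x))"
      by (intro integrable_norm locally_integrable_indicator assms compact_cbox)
    show "AE x in lebesgue_on \<Omega>. (\<lambda>n. f x * box_bump a c n x) \<longlonglongrightarrow> f x * indicator (box a c) x"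
      by (intro AE_I2 tendsto_mult tendsto_const box_bump_tendsto_indicator)
    show "(\<lambda>x. f x * box_bump a c n x) \<in> borel_measurable (lebesgue_on \<Omega>)" for n
      using meas by measurable
    have "box a c \<in> sets lebesgue" by auto
    then have "indicat_real (box a c) \<in> borel_measurable (lebesgue_on \<Omega>)"
      by (intro measurable_restrict_space1 borel_measurable_indicator)
    then show "(\<lambda>x. f x * indicator (box a c) x) \<in> borel_measurable (lebesgue_on \<Omega>)"
      by measurable
    have "norm (f x * box_bump a c n x) \<le> norm (indicator (cbox a c) x *\<^sub>R f x)" for n x
    proof (cases "x \<in> box a c")
      case True
      then have "x \<in> cbox a c" using box_subset_cbox by blast
      then show ?thesis
        using box_bump_nonneg[of a c n x] box_bump_le_1[of a c n x]
        by (simp add: abs_mult mult_left_le)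
    qed (simp add: box_bump_eq_0_iff[THEN iffD2])
    then show "AE x in lebesgue_on \<Omega>. norm (f x * box_bump a c n x) \<le> norm (indicator (cbox a c) x *\<^sub>R f x)" for n
      by simp
  qed
  moreover have "(\<integral>x. f x * box_bump a c n x \<partial>lebesgue_on \<Omega>) = 0" for n
    by (intro test box_bump_in_test_functions sub)
  ultimately have "(\<integral>x. f x * indicator (box a c) x \<partial>lebesgue_on \<Omega>) = 0"
    by (simp add: LIMSEQ_const_iff)
  moreover have "(\<integral>x. f x * indicator (box a c) x \<partial>lebesgue_on \<Omega>) = (\<integral>x. indicator (box a c) x * f x \<partial>lebesgue)"
    using subset_trans[OF box_subset_cbox sub] \<open>open \<Omega>\<close>
    by (subst integral_restrict_space) (auto intro!: Bochner_Integration.integral_cong simp: indicator_def)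
  ultimately show ?thesis by simp
qed

text \<open>On a closed box inside \<open>\<Omega>\<close> the function \<open>f\<close> is integrable, and all its integrals over smaller
  boxes vanish, so it is zero there almost everywhere. Countably many such boxes cover \<open>\<Omega>\<close>.\<close>

lemma fundamental_lemma_calculus_of_variations:
  fixes f :: "'a::euclidean_space \<Rightarrow> real"
  assumes "open \<Omega>" and f: "locally_integrable \<Omega> f"
    and test: "\<And>\<phi>. \<phi> \<in> test_functions \<Omega> \<Longrightarrow> (\<integral>x. f x * \<phi> x \<partial>lebesgue_on \<Omega>) = 0"
  shows "AE x in lebesgue_on \<Omega>. f x = 0"
proof -
  have cbox: "AE x in lebesgue. x \<in> cbox a c \<longrightarrow> f x = 0" if sub: "cbox a c \<subseteq> \<Omega>" for a c
  proof -
    let ?f = "\<lambda>x. indicator (box a c) x * f x"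
    have "integrable (lebesgue_on (cbox a c)) f"
      using f sub compact_cbox unfolding locally_integrable_def by blast
    then have "integrable lebesgue (\<lambda>x. indicator (cbox a c) x *\<^sub>R f x)"
      by (simp add: integrable_restrict_space)
    then have "integrable lebesgue (\<lambda>x. indicator (box a c) x *\<^sub>R (indicator (cbox a c) x *\<^sub>R f x))"
      by (rule integrable_mult_indicator[rotated]) auto
    moreover have "(\<lambda>x. indicator (box a c) x *\<^sub>R (indicator (cbox a c) x *\<^sub>R f x)) = ?f"
      using box_subset_cbox[of a c] by (auto simp: indicator_def fun_eq_iff)
    ultimately have int: "integrable lebesgue ?f" by simp
    \<comment> \<open>The Dynkin system argument needs a Borel measurable representative.\<close>
    then obtain f' where f': "f' \<in> borel_measurable lborel" "AE x in lborel. ?f x = f' x"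
      using completion_ex_borel_measurable_real by blast
    then have ae: "AE x in lebesgue. ?f x = f' x" by (intro AE_completion)
    have meas': "f' \<in> borel_measurable lebesgue"
      using f'(1) by (rule measurable_completion)
    have "integrable lebesgue f'"
      using integrable_cong_AE_imp[OF int meas'] ae by auto
    then have int': "integrable lborel f'"
      using f'(1) by (simp add: integrable_completion)
    have box: "(LINT x:box a' c'|lborel. f' x) = 0" for a' c'
    proof -
      obtain d e where de: "box a' c' \<inter> box a c = box d e" "box d e = {} \<or> cbox d e \<subseteq> cbox a c"
      proof (cases "box a' c' \<inter> box a c = {}")
        case True
        then show ?thesis using that[of 0 0] by simp
      next
        case False
        obtain d e where de: "box a' c' \<inter> box a c = box d e"
          unfolding box_Int_box by blast
        then have "box d e \<noteq> {}" "box d e \<subseteq> cbox a c"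
          using False box_subset_cbox by blast+
        then have "cbox d e \<subseteq> cbox a c"
          by (metis closed_cbox closure_box closure_minimal)
        with de show ?thesis using that by blast
      qed
      have "(LINT x:box a' c'|lborel. f' x) = (\<integral>x. indicator (box a' c') x * f' x \<partial>lebesgue)"
        unfolding set_lebesgue_integral_def using f'(1) by (subst integral_completion) auto
      also have "\<dots> = (\<integral>x. indicator (box a' c') x * ?f x \<partial>lebesgue)"
      proof (rule integral_cong_AE)
        have *: "indicat_real (box a' c') \<in> borel_measurable lebesgue"
          by (intro borel_measurable_indicator) auto
        show "(\<lambda>x. indicator (box a' c') x * f' x) \<in> borel_measurable lebesgue"
          using * meas' by (intro borel_measurable_times)
        show "(\<lambda>x. indicator (box a' c') x * ?f x) \<in> borel_measurable lebesgue"
          using int by (intro borel_measurable_times[OF *]) auto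
        show "AE x in lebesgue. indicator (box a' c') x * f' x = indicator (box a' c') x * ?f x"
          using ae by eventually_elim simp
      qed
      also have "\<dots> = (\<integral>x. indicator (box d e) x * f x \<partial>lebesgue)"
        unfolding de(1)[symmetric] by (intro Bochner_Integration.integral_cong) (auto simp: indicator_def)
      also have "\<dots> = 0"
        using de(2)
      proof
        assume "cbox d e \<subseteq> cbox a c"
        then show ?thesis
          using sub by (intro box_integral_eq_0[OF assms]) auto
      qed simp
      finally show ?thesis .
    qed
    have "(\<integral>x. f' x \<partial>lborel) = (\<integral>x. f' x \<partial>lebesgue)"
      using f'(1) by (simp add: integral_completion)
    also have "\<dots> = (\<integral>x. ?f x \<partial>lebesgue)"
      by (rule integral_cong_AE) (use ae meas' int in auto)
    also have "\<dots> = 0"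
      by (rule box_integral_eq_0[OF assms sub])
    finally have "AE x in lborel. f' x = 0"
      using AE_eq_0_if_box_integrals_eq_0[OF int' _ box] by blast
    then have "AE x in lebesgue. f' x = 0" by (rule AE_completion)
    moreover have "AE x in lebesgue. x \<notin> cbox a c - box a c"
      using negligible_frontier_interval[of a c] by (intro AE_not_in) (simp add: negligible_iff_null_sets)
    ultimately show ?thesis
      using ae
    proof eventually_elim
      case (elim x)
      then show ?case by (cases "x \<in> box a c") (simp_all add: indicator_def)
    qed
  qed
  obtain \<D> where \<D>: "countable \<D>" "\<D> \<subseteq> Pow \<Omega>" "\<And>X. X \<in> \<D> \<Longrightarrow> \<exists>a b. X = cbox a b" "\<Union>\<D> = \<Omega>"
    using open_countable_Union_open_cbox[OF \<open>open \<Omega>\<close>] by metis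
  have "AE x in lebesgue. x \<in> X \<longrightarrow> f x = 0" if X: "X \<in> \<D>" for X
  proof -
    obtain a c where "X = cbox a c" using \<D>(3)[OF X] by blast
    then show ?thesis using cbox[of a c] X \<D>(2) by blast
  qed
  then have "AE x in lebesgue. \<forall>X\<in>\<D>. x \<in> X \<longrightarrow> f x = 0"
    by (subst AE_ball_countable[OF \<D>(1)]) (rule ballI)
  then have "AE x in lebesgue. x \<in> \<Omega> \<longrightarrow> f x = 0"
    by eventually_elim (use \<D>(4) in blast)
  then show ?thesis
    using \<open>open \<Omega>\<close> by (simp add: AE_restrict_space_iff)
qed

section \<open>Weak gradients\<close>

lemma test_function_times_integrable:
  fixes f :: "'a::euclidean_space \<Rightarrow> real"
  assumes "open \<Omega>" "locally_integrable \<Omega> f" "\<phi> \<in> test_functions \<Omega>"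
  shows "integrable (lebesgue_on \<Omega>) (\<lambda>x. f x * \<phi> x)"
    and "b \<in> Basis \<Longrightarrow> integrable (lebesgue_on \<Omega>) (\<lambda>x. f x * frechet_derivative \<phi> (at x) b)"
proof -
  define K where "K = closure {x. \<phi> x \<noteq> 0}"
  have K: "compact K" "K \<subseteq> \<Omega>" using assms(3) by (auto simp: test_functions_def K_def)
  have out: "\<phi> x = 0" "frechet_derivative \<phi> (at x) b = 0" if "x \<notin> K" for x b
    using that closure_subset[of "{x. \<phi> x \<noteq> 0}"]
    by (auto simp: derivative_eq_0_outside_support K_def)
  show "integrable (lebesgue_on \<Omega>) (\<lambda>x. f x * \<phi> x)"
    using locally_integrable_mult_compact_support[OF assms(1,2) K
        test_function_continuous[OF assms(3)] out(1)] by (simp add: mult.commute)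
  show "integrable (lebesgue_on \<Omega>) (\<lambda>x. f x * frechet_derivative \<phi> (at x) b)" if "b \<in> Basis"
    using locally_integrable_mult_compact_support[OF assms(1,2) K
        test_function_partial_continuous[OF assms(3) that] out(2)] by (simp add: mult.commute)
qed

lemma locally_integrable_inner:
  "locally_integrable \<Omega> g \<Longrightarrow> locally_integrable \<Omega> (\<lambda>x. g x \<bullet> b)"
  unfolding locally_integrable_def by (auto intro: integrable_inner_left)

lemma locally_integrable_lincomb:
  "locally_integrable \<Omega> f \<Longrightarrow> locally_integrable \<Omega> g \<Longrightarrow> locally_integrable \<Omega> (\<lambda>x. a *\<^sub>R f x + c *\<^sub>R g x)"
  unfolding locally_integrable_def by auto

lemma is_weak_gradient_lincomb:
  assumes "open \<Omega>" "is_weak_gradient \<Omega> u g" "is_weak_gradient \<Omega> v h"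
  shows "is_weak_gradient \<Omega> (\<lambda>x. a * u x + c * v x) (\<lambda>x. a *\<^sub>R g x + c *\<^sub>R h x)"
  unfolding is_weak_gradient_def
proof (intro conjI ballI)
  have loc: "locally_integrable \<Omega> u" "locally_integrable \<Omega> v" "locally_integrable \<Omega> g" "locally_integrable \<Omega> h"
    using assms by (auto simp: is_weak_gradient_def)
  then show "locally_integrable \<Omega> (\<lambda>x. a * u x + c * v x)"
    using locally_integrable_lincomb[of \<Omega> u v a c] by simp
  show "locally_integrable \<Omega> (\<lambda>x. a *\<^sub>R g x + c *\<^sub>R h x)"
    using loc by (intro locally_integrable_lincomb)
  fix \<phi> b assume \<phi>: "\<phi> \<in> test_functions \<Omega>" and b: "b \<in> (Basis :: 'a set)"
  let ?D = "\<lambda>x. frechet_derivative \<phi> (at x) b"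
  note int = test_function_times_integrable[OF assms(1) loc(1) \<phi>]
    test_function_times_integrable[OF assms(1) loc(2) \<phi>]
    test_function_times_integrable[OF assms(1) locally_integrable_inner[OF loc(3)] \<phi>]
    test_function_times_integrable[OF assms(1) locally_integrable_inner[OF loc(4)] \<phi>]
  have "(\<integral>x. (a * u x + c * v x) * ?D x \<partial>lebesgue_on \<Omega>)
    = a * (\<integral>x. u x * ?D x \<partial>lebesgue_on \<Omega>) + c * (\<integral>x. v x * ?D x \<partial>lebesgue_on \<Omega>)"
    using int b by (simp add: algebra_simps)
  also have "\<dots> = - (a * (\<integral>x. (g x \<bullet> b) * \<phi> x \<partial>lebesgue_on \<Omega>) + c * (\<integral>x. (h x \<bullet> b) * \<phi> x \<partial>lebesgue_on \<Omega>))"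
    using assms(2,3) \<phi> b by (simp add: is_weak_gradient_def)
  also have "\<dots> = - (\<integral>x. ((a *\<^sub>R g x + c *\<^sub>R h x) \<bullet> b) * \<phi> x \<partial>lebesgue_on \<Omega>)"
    using int by (simp add: algebra_simps)
  finally show "(\<integral>x. (a * u x + c * v x) * ?D x \<partial>lebesgue_on \<Omega>)
    = - (\<integral>x. ((a *\<^sub>R g x + c *\<^sub>R h x) \<bullet> b) * \<phi> x \<partial>lebesgue_on \<Omega>)" .
qed

text \<open>Each component of the difference of two weak gradients is orthogonal to all test functions.\<close>

lemma is_weak_gradient_unique:
  assumes "open \<Omega>" "is_weak_gradient \<Omega> u g" "is_weak_gradient \<Omega> u h"
  shows "AE x in lebesgue_on \<Omega>. g x = h x"
proof -
  have loc: "locally_integrable \<Omega> g" "locally_integrable \<Omega> h"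
    using assms by (auto simp: is_weak_gradient_def)
  have "AE x in lebesgue_on \<Omega>. g x \<bullet> b - h x \<bullet> b = 0" if b: "b \<in> Basis" for b
  proof (rule fundamental_lemma_calculus_of_variations[OF \<open>open \<Omega>\<close>])
    show "locally_integrable \<Omega> (\<lambda>x. g x \<bullet> b - h x \<bullet> b)"
      using locally_integrable_lincomb[OF loc[THEN locally_integrable_inner], of 1 b "- 1" b] by simp
    fix \<phi> assume \<phi>: "\<phi> \<in> test_functions \<Omega>"
    note int = test_function_times_integrable[OF assms(1) locally_integrable_inner[OF loc(1)] \<phi>]
      test_function_times_integrable[OF assms(1) locally_integrable_inner[OF loc(2)] \<phi>]
    have "(\<integral>x. (g x \<bullet> b - h x \<bullet> b) * \<phi> x \<partial>lebesgue_on \<Omega>)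
        = (\<integral>x. (g x \<bullet> b) * \<phi> x \<partial>lebesgue_on \<Omega>) - (\<integral>x. (h x \<bullet> b) * \<phi> x \<partial>lebesgue_on \<Omega>)"
      using int by (simp add: left_diff_distrib)
    also have "\<dots> = 0"
      using assms(2,3) \<phi> b by (simp add: is_weak_gradient_def)
    finally show "(\<integral>x. (g x \<bullet> b - h x \<bullet> b) * \<phi> x \<partial>lebesgue_on \<Omega>) = 0" .
  qed
  then have "AE x in lebesgue_on \<Omega>. \<forall>b\<in>Basis. g x \<bullet> b - h x \<bullet> b = 0"
    by (intro AE_finite_allI) auto
  then show ?thesis
    by eventually_elim (rule euclidean_eqI, simp)
qed

text \<open>This lemma replaces the chosen weak gradient by any concrete one. Measurability is recorded
  separately, since integrals of almost everywhere equal functions are only known to agree for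
  measurable functions.\<close>

lemma weak_grad_AE_eq:
  assumes "open \<Omega>" "is_weak_gradient \<Omega> u g"
  shows "is_weak_gradient \<Omega> u (weak_grad \<Omega> u)"
    and "weak_grad \<Omega> u \<in> borel_measurable (lebesgue_on \<Omega>)"
    and "AE x in lebesgue_on \<Omega>. weak_grad \<Omega> u x = g x"
proof -
  show *: "is_weak_gradient \<Omega> u (weak_grad \<Omega> u)"
    unfolding weak_grad_def by (rule someI[where P = "is_weak_gradient \<Omega> u", OF assms(2)])
  then show "weak_grad \<Omega> u \<in> borel_measurable (lebesgue_on \<Omega>)"
    using locally_integrable_imp_measurable[OF assms(1)] by (auto simp: is_weak_gradient_def)
  show "AE x in lebesgue_on \<Omega>. weak_grad \<Omega> u x = g x"
    by (rule is_weak_gradient_unique[OF assms(1) * assms(2)])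
qed

lemma Lp_cong_AE:
  assumes "f \<in> Lp M r" and [measurable]: "g \<in> borel_measurable M" and ae: "AE x in M. g x = f x"
  shows "g \<in> Lp M r"
proof -
  have [measurable]: "f \<in> borel_measurable M" and int: "integrable M (\<lambda>x. norm (f x) powr r)"
    using assms(1) by (auto simp: Lp_def)
  have "integrable M (\<lambda>x. norm (g x) powr r)"
    by (rule integrable_cong_AE_imp[OF int]) (use ae in auto)
  then show ?thesis by (simp add: Lp_def)
qed

lemma W1_weak_grad:
  assumes "open \<Omega>" "u \<in> W1 \<Omega> s"
  shows "is_weak_gradient \<Omega> u (weak_grad \<Omega> u)" "weak_grad \<Omega> u \<in> Lp (lebesgue_on \<Omega>) s"
proof -
  obtain g where g: "g \<in> Lp (lebesgue_on \<Omega>) s" "is_weak_gradient \<Omega> u g"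
    using assms(2) by (auto simp: W1_def)
  note * = weak_grad_AE_eq[OF assms(1) g(2)]
  show "is_weak_gradient \<Omega> u (weak_grad \<Omega> u)" by fact
  show "weak_grad \<Omega> u \<in> Lp (lebesgue_on \<Omega>) s"
    by (rule Lp_cong_AE[OF g(1)]) (use * in auto)
qed

lemma weak_grad_lincomb:
  assumes "open \<Omega>" "is_weak_gradient \<Omega> u g" "is_weak_gradient \<Omega> v h"
  shows "AE x in lebesgue_on \<Omega>. weak_grad \<Omega> (\<lambda>x. a * u x + c * v x) x
      = a *\<^sub>R weak_grad \<Omega> u x + c *\<^sub>R weak_grad \<Omega> v x"
    and "weak_grad \<Omega> (\<lambda>x. a * u x + c * v x) \<in> borel_measurable (lebesgue_on \<Omega>)"
  using weak_grad_AE_eq[OF assms(1) is_weak_gradient_lincomb[OF assms(1)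
      weak_grad_AE_eq(1)[OF assms(1,2)] weak_grad_AE_eq(1)[OF assms(1,3)]], of a c] by blast+

section \<open>Test functions as elements of the Sobolev spaces\<close>

lemma finite_measure_lebesgue_on_bounded_open:
  "open \<Omega> \<Longrightarrow> bounded \<Omega> \<Longrightarrow> finite_measure (lebesgue_on \<Omega>)"
  by (intro finite_measure_lebesgue_on lmeasurable_open)

lemma test_function_measurable:
  assumes "\<phi> \<in> test_functions \<Omega>"
  shows "\<phi> \<in> borel_measurable (lebesgue_on S)" "grad \<phi> \<in> borel_measurable (lebesgue_on S)"
  by (rule continuous_imp_measurable_lebesgue_on test_function_continuous[OF assms]
      grad_continuous[OF assms])+

lemma test_function_in_Lp:
  assumes "open \<Omega>" "bounded \<Omega>" "\<phi> \<in> test_functions \<Omega>" "r \<ge> 0"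
  shows "\<phi> \<in> Lp (lebesgue_on \<Omega>) r" "grad \<phi> \<in> Lp (lebesgue_on \<Omega>) r"
proof -
  interpret finite_measure "lebesgue_on \<Omega>"
    by (rule finite_measure_lebesgue_on_bounded_open) fact+
  obtain M where M: "\<And>x. norm (\<phi> x) \<le> M" "\<And>x. norm (grad \<phi> x) \<le> M"
    using test_function_bounded[OF assms(3)] by (metis real_norm_def)
  show "\<phi> \<in> Lp (lebesgue_on \<Omega>) r"
    by (rule bounded_in_Lp[OF test_function_measurable(1)[OF assms(3)] M(1) assms(4)])
  show "grad \<phi> \<in> Lp (lebesgue_on \<Omega>) r"
    by (rule bounded_in_Lp[OF test_function_measurable(2)[OF assms(3)] M(2) assms(4)])
qed

lemma weak_grad_test_function:
  assumes "open \<Omega>" "\<phi> \<in> test_functions \<Omega>"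
  shows "AE x in lebesgue_on \<Omega>. weak_grad \<Omega> \<phi> x = grad \<phi> x"
    and "weak_grad \<Omega> \<phi> \<in> borel_measurable (lebesgue_on \<Omega>)"
  using weak_grad_AE_eq[OF assms(1) test_function_weak_gradient[OF assms]] by auto

lemma W1_norm_test_function:
  assumes "open \<Omega>" "\<phi> \<in> test_functions \<Omega>"
  shows "W1_norm \<Omega> s \<phi> = Lp_norm (lebesgue_on \<Omega>) s \<phi> + Lp_norm (lebesgue_on \<Omega>) s (grad \<phi>)"
proof -
  have "Lp_norm (lebesgue_on \<Omega>) s (weak_grad \<Omega> \<phi>) = Lp_norm (lebesgue_on \<Omega>) s (grad \<phi>)"
  proof (rule Lp_norm_cong_AE)
    show "AE x in lebesgue_on \<Omega>. norm (weak_grad \<Omega> \<phi> x) = norm (grad \<phi> x)"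
      using weak_grad_test_function(1)[OF assms] by eventually_elim simp
  qed (simp_all add: weak_grad_test_function[OF assms] test_function_measurable[OF assms(2)])
  then show ?thesis by (simp add: W1_norm_def)
qed

lemma grad_zero: "grad (0 :: 'a::euclidean_space \<Rightarrow> real) = (\<lambda>x. 0)"
  by (simp add: grad_def[abs_def] zero_fun_def)

lemma W1_norm_zero: "open \<Omega> \<Longrightarrow> W1_norm \<Omega> s 0 = 0"
  by (simp add: W1_norm_test_function zero_in_test_functions grad_zero Lp_norm_def)

lemma W1_norm_nonneg: "0 \<le> W1_norm \<Omega> s u"
  by (simp add: W1_norm_def Lp_norm_nonneg)

lemma test_function_in_W1_0:
  assumes "open \<Omega>" "bounded \<Omega>" "\<phi> \<in> test_functions \<Omega>" "s \<ge> 0"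
  shows "\<phi> \<in> W1_0 \<Omega> s"
proof -
  have "\<phi> \<in> W1 \<Omega> s"
    using test_function_in_Lp[OF assms] test_function_weak_gradient[OF assms(1,3)]
    by (auto simp: W1_def)
  moreover have "(\<lambda>n::nat. W1_norm \<Omega> s (\<phi> - \<phi>)) \<longlonglongrightarrow> 0"
    by (simp add: W1_norm_zero assms(1))
  ultimately show ?thesis
    using assms(3) unfolding W1_0_def by (intro CollectI conjI exI[of _ "\<lambda>_. \<phi>"]) auto
qed

lemma W1_norm_test_function_le:
  assumes "open \<Omega>" "bounded \<Omega>" "\<phi> \<in> test_functions \<Omega>" "s > 0"
    and "\<And>x. \<bar>\<phi> x\<bar> \<le> B" "\<And>x. norm (grad \<phi> x) \<le> B"
  shows "W1_norm \<Omega> s \<phi> \<le> B * (2 * measure lebesgue \<Omega> powr (1 / s))"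
proof -
  interpret finite_measure "lebesgue_on \<Omega>"
    by (rule finite_measure_lebesgue_on_bounded_open) fact+
  have "Lp_norm (lebesgue_on \<Omega>) s \<phi> \<le> B * measure (lebesgue_on \<Omega>) (space (lebesgue_on \<Omega>)) powr (1 / s)"
    by (rule Lp_norm_le_of_bounded) (simp_all add: assms test_function_measurable[OF assms(3)])
  moreover have "Lp_norm (lebesgue_on \<Omega>) s (grad \<phi>) \<le> B * measure (lebesgue_on \<Omega>) (space (lebesgue_on \<Omega>)) powr (1 / s)"
    by (rule Lp_norm_le_of_bounded) (simp_all add: assms test_function_measurable[OF assms(3)])
  ultimately show ?thesis
    using assms by (simp add: W1_norm_test_function measure_restrict_space)
qed

section \<open>Differentiability of the functional\<close>

definition dirichlet_form :: "'a::euclidean_space set \<Rightarrow> ('a \<Rightarrow> real) \<Rightarrow> ('a \<Rightarrow> real) \<Rightarrow> real" where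
  "dirichlet_form \<Omega> u v = (\<integral>x. weak_grad \<Omega> u x \<bullet> weak_grad \<Omega> v x \<partial>lebesgue_on \<Omega>)"

lemma dirichlet_form_bound:
  assumes "open \<Omega>" "s > 1" "u \<in> W1 \<Omega> s" "v \<in> W1 \<Omega> (s / (s - 1))"
  shows "integrable (lebesgue_on \<Omega>) (\<lambda>x. weak_grad \<Omega> u x \<bullet> weak_grad \<Omega> v x)"
    and "\<bar>dirichlet_form \<Omega> u v\<bar> \<le> W1_norm \<Omega> s u * W1_norm \<Omega> (s / (s - 1)) v"
proof -
  note H = Holder_inner[OF assms(2) W1_weak_grad(2)[OF assms(1,3)] W1_weak_grad(2)[OF assms(1,4)]]
  show "integrable (lebesgue_on \<Omega>) (\<lambda>x. weak_grad \<Omega> u x \<bullet> weak_grad \<Omega> v x)" by (rule H(1))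
  have "Lp_norm (lebesgue_on \<Omega>) s (weak_grad \<Omega> u) * Lp_norm (lebesgue_on \<Omega>) (s / (s - 1)) (weak_grad \<Omega> v)
    \<le> W1_norm \<Omega> s u * W1_norm \<Omega> (s / (s - 1)) v"
    unfolding W1_norm_def by (intro mult_mono) (simp_all add: Lp_norm_nonneg)
  with H(2) show "\<bar>dirichlet_form \<Omega> u v\<bar> \<le> W1_norm \<Omega> s u * W1_norm \<Omega> (s / (s - 1)) v"
    unfolding dirichlet_form_def by linarith
qed

text \<open>The chosen weak gradient is linear only almost everywhere, by the uniqueness of weak gradients.\<close>

lemma dirichlet_form_bilinear:
  assumes "open \<Omega>" "s > 1" "u \<in> W1 \<Omega> s" "h \<in> W1 \<Omega> s" "v \<in> W1 \<Omega> (s / (s - 1))" "k \<in> W1 \<Omega> (s / (s - 1))"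
  shows "dirichlet_form \<Omega> (\<lambda>x. a * u x + c * h x) (\<lambda>x. b * v x + d * k x) =
    a * b * dirichlet_form \<Omega> u v + a * d * dirichlet_form \<Omega> u k +
    c * b * dirichlet_form \<Omega> h v + c * d * dirichlet_form \<Omega> h k"
proof -
  note w = W1_weak_grad[OF assms(1,3)] W1_weak_grad[OF assms(1,4)]
    W1_weak_grad[OF assms(1,5)] W1_weak_grad[OF assms(1,6)]
  let ?wu = "weak_grad \<Omega> u" and ?wh = "weak_grad \<Omega> h" and ?wv = "weak_grad \<Omega> v" and ?wk = "weak_grad \<Omega> k"
  note L = weak_grad_lincomb[OF assms(1) w(1) w(3), of a c]
  note R = weak_grad_lincomb[OF assms(1) w(5) w(7), of b d]
  have [measurable]: "?wu \<in> borel_measurable (lebesgue_on \<Omega>)" "?wh \<in> borel_measurable (lebesgue_on \<Omega>)"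
    "?wv \<in> borel_measurable (lebesgue_on \<Omega>)" "?wk \<in> borel_measurable (lebesgue_on \<Omega>)"
    using w by (auto simp: Lp_def)
  note [measurable] = L(2) R(2)
  have "dirichlet_form \<Omega> (\<lambda>x. a * u x + c * h x) (\<lambda>x. b * v x + d * k x) =
      (\<integral>x. a * b * (?wu x \<bullet> ?wv x) + a * d * (?wu x \<bullet> ?wk x)
        + c * b * (?wh x \<bullet> ?wv x) + c * d * (?wh x \<bullet> ?wk x) \<partial>lebesgue_on \<Omega>)"
    unfolding dirichlet_form_def
  proof (rule integral_cong_AE)
    show "AE x in lebesgue_on \<Omega>.
      weak_grad \<Omega> (\<lambda>x. a * u x + c * h x) x \<bullet> weak_grad \<Omega> (\<lambda>x. b * v x + d * k x) x =
      a * b * (?wu x \<bullet> ?wv x) + a * d * (?wu x \<bullet> ?wk x) + c * b * (?wh x \<bullet> ?wv x) + c * d * (?wh x \<bullet> ?wk x)"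
      using L(1) R(1)
      by eventually_elim (simp add: inner_add_left inner_add_right algebra_simps)
  qed measurable
  also have "\<dots> = a * b * dirichlet_form \<Omega> u v + a * d * dirichlet_form \<Omega> u k +
      c * b * dirichlet_form \<Omega> h v + c * d * dirichlet_form \<Omega> h k"
    using dirichlet_form_bound(1)[OF assms(1,2,3,5)] dirichlet_form_bound(1)[OF assms(1,2,3,6)]
      dirichlet_form_bound(1)[OF assms(1,2,4,5)] dirichlet_form_bound(1)[OF assms(1,2,4,6)]
    by (simp add: dirichlet_form_def)
  finally show ?thesis .
qed

lemma (in finite_measure) odd_powr_mult_integral:
  fixes f h :: "'a \<Rightarrow> real"
  assumes "p > 0" and [measurable]: "f \<in> borel_measurable M" and f: "\<And>x. \<bar>f x\<bar> \<le> B"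
    and h: "h \<in> Lp M (p + 1)"
  shows "integrable M (\<lambda>x. odd_powr p (f x) * h x)"
    and "\<bar>\<integral>x. odd_powr p (f x) * h x \<partial>M\<bar>
      \<le> B powr p * measure M (space M) powr (1 - 1 / (p + 1)) * Lp_norm M (p + 1) h"
proof -
  have [measurable]: "h \<in> borel_measurable M" using h by (simp add: Lp_def)
  have r: "p + 1 > 1" using \<open>p > 0\<close> by simp
  note L1 = Lp_imp_integrable[OF r h]
  have bound: "\<bar>odd_powr p (f x) * h x\<bar> \<le> B powr p * \<bar>h x\<bar>" for x
    unfolding abs_mult abs_odd_powr using f \<open>p > 0\<close> by (intro mult_right_mono powr_mono2) auto
  have abs: "integrable M (\<lambda>x. B powr p * \<bar>h x\<bar>)" using L1(1) by simp
  show int: "integrable M (\<lambda>x. odd_powr p (f x) * h x)"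
    by (rule Bochner_Integration.integrable_bound[OF abs])
      (use bound in \<open>auto intro!: AE_I2 order_trans[OF _ abs_ge_self]\<close>)
  have "\<bar>\<integral>x. odd_powr p (f x) * h x \<partial>M\<bar> \<le> (\<integral>x. \<bar>odd_powr p (f x) * h x\<bar> \<partial>M)"
    by (rule integral_abs_bound)
  also have "\<dots> \<le> (\<integral>x. B powr p * \<bar>h x\<bar> \<partial>M)"
    by (rule integral_mono) (use int abs bound in auto)
  also have "\<dots> \<le> B powr p * (measure M (space M) powr (1 - 1 / (p + 1)) * Lp_norm M (p + 1) h)"
    using L1(2) by (simp add: mult_left_mono)
  finally show "\<bar>\<integral>x. odd_powr p (f x) * h x \<partial>M\<bar>
      \<le> B powr p * measure M (space M) powr (1 - 1 / (p + 1)) * Lp_norm M (p + 1) h"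
    by (simp add: mult.assoc)
qed

text \<open>The integral of the pointwise remainder bound. Its linear part is a small multiple of the
  \<open>L\<^sup>1\<close>-norm of \<open>h\<close>, hence of the \<open>L\<^sup>p\<^sup>+\<^sup>1\<close>-norm on a finite measure space. The same bound shows that the
  \<open>p + 1\<close>-st power of \<open>f + h\<close> is integrable.\<close>

lemma (in finite_measure) power_functional_remainder:
  fixes f :: "'a \<Rightarrow> real"
  assumes "p > 0" and [measurable]: "f \<in> borel_measurable M" and f: "\<And>x. \<bar>f x\<bar> \<le> B" and "\<epsilon> > 0"
  obtains C where "C \<ge> 0" "\<And>h. h \<in> Lp M (p + 1) \<Longrightarrow> integrable M (\<lambda>x. \<bar>f x + h x\<bar> powr (p + 1) / (p + 1))"
    "\<And>h. h \<in> Lp M (p + 1) \<Longrightarrow>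
      \<bar>(\<integral>x. \<bar>f x + h x\<bar> powr (p + 1) / (p + 1) \<partial>M) - (\<integral>x. \<bar>f x\<bar> powr (p + 1) / (p + 1) \<partial>M)
        - (\<integral>x. odd_powr p (f x) * h x \<partial>M)\<bar> \<le> \<epsilon> * Lp_norm M (p + 1) h + C * Lp_norm M (p + 1) h powr (p + 1)"
proof -
  define K where "K = measure M (space M) powr (1 - 1 / (p + 1))"
  have "K \<ge> 0" by (simp add: K_def)
  define \<epsilon>' where "\<epsilon>' = \<epsilon> / (K + 1)"
  have \<epsilon>': "\<epsilon>' > 0" "\<epsilon>' * K \<le> \<epsilon>"
    using \<open>\<epsilon> > 0\<close> \<open>K \<ge> 0\<close> by (auto simp: \<epsilon>'_def field_simps)
  obtain C where "C \<ge> 0" and C: "\<And>a b. \<bar>a\<bar> \<le> max 0 B \<Longrightarrow>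
    \<bar>\<bar>a + b\<bar> powr (p + 1) / (p + 1) - \<bar>a\<bar> powr (p + 1) / (p + 1) - odd_powr p a * b\<bar>
      \<le> \<epsilon>' * \<bar>b\<bar> + C * \<bar>b\<bar> powr (p + 1)"
    using abs_powr_remainder[OF \<open>p > 0\<close> _ \<epsilon>'(1), of "max 0 B"] by auto
  have r: "p + 1 > 1" using \<open>p > 0\<close> by simp
  have "integrable M (\<lambda>x. \<bar>f x + h x\<bar> powr (p + 1) / (p + 1)) \<and>
      \<bar>(\<integral>x. \<bar>f x + h x\<bar> powr (p + 1) / (p + 1) \<partial>M) - (\<integral>x. \<bar>f x\<bar> powr (p + 1) / (p + 1) \<partial>M)
        - (\<integral>x. odd_powr p (f x) * h x \<partial>M)\<bar> \<le> \<epsilon> * Lp_norm M (p + 1) h + C * Lp_norm M (p + 1) h powr (p + 1)"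
    if h: "h \<in> Lp M (p + 1)" for h
  proof -
    have [measurable]: "h \<in> borel_measurable M" and hp: "integrable M (\<lambda>x. \<bar>h x\<bar> powr (p + 1))"
      using h by (auto simp: Lp_def)
    define R where "R x = \<bar>f x + h x\<bar> powr (p + 1) / (p + 1) - \<bar>f x\<bar> powr (p + 1) / (p + 1) - odd_powr p (f x) * h x" for x
    have R: "\<bar>R x\<bar> \<le> \<epsilon>' * \<bar>h x\<bar> + C * \<bar>h x\<bar> powr (p + 1)" for x
      unfolding R_def by (rule C) (use f[of x] in auto)
    have [measurable]: "R \<in> borel_measurable M" unfolding R_def by measurable
    note L1 = Lp_imp_integrable[OF r h]
    have int_bd: "integrable M (\<lambda>x. \<epsilon>' * \<bar>h x\<bar> + C * \<bar>h x\<bar> powr (p + 1))"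
      using L1(1) hp by simp
    have int_R: "integrable M R"
      by (rule Bochner_Integration.integrable_bound[OF int_bd])
        (use R in \<open>auto intro!: AE_I2 order_trans[OF _ abs_ge_self]\<close>)
    have int_f: "integrable M (\<lambda>x. \<bar>f x\<bar> powr (p + 1) / (p + 1))"
      using bounded_in_Lp[of f B "p + 1"] f \<open>p > 0\<close> by (simp add: Lp_def)
    note int_D = odd_powr_mult_integral(1)[OF \<open>p > 0\<close> \<open>f \<in> borel_measurable M\<close> f h]
    have eq: "(\<lambda>x. \<bar>f x + h x\<bar> powr (p + 1) / (p + 1)) = (\<lambda>x. R x + \<bar>f x\<bar> powr (p + 1) / (p + 1) + odd_powr p (f x) * h x)"
      by (auto simp: R_def)
    have int: "integrable M (\<lambda>x. \<bar>f x + h x\<bar> powr (p + 1) / (p + 1))"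
      unfolding eq by (intro Bochner_Integration.integrable_add int_R int_f int_D)
    have "(\<integral>x. \<bar>f x + h x\<bar> powr (p + 1) / (p + 1) \<partial>M) - (\<integral>x. \<bar>f x\<bar> powr (p + 1) / (p + 1) \<partial>M)
        - (\<integral>x. odd_powr p (f x) * h x \<partial>M) = integral\<^sup>L M R"
      unfolding eq
      by (subst Bochner_Integration.integral_add[OF Bochner_Integration.integrable_add[OF int_R int_f] int_D],
          subst Bochner_Integration.integral_add[OF int_R int_f]) simp
    moreover have "\<bar>integral\<^sup>L M R\<bar> \<le> (\<integral>x. \<bar>R x\<bar> \<partial>M)"
      by (rule integral_abs_bound)
    moreover have "(\<integral>x. \<bar>R x\<bar> \<partial>M) \<le> (\<integral>x. \<epsilon>' * \<bar>h x\<bar> + C * \<bar>h x\<bar> powr (p + 1) \<partial>M)"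
      by (rule integral_mono) (use R int_R int_bd in auto)
    moreover have "(\<integral>x. \<epsilon>' * \<bar>h x\<bar> + C * \<bar>h x\<bar> powr (p + 1) \<partial>M)
        = \<epsilon>' * (\<integral>x. \<bar>h x\<bar> \<partial>M) + C * Lp_norm M (p + 1) h powr (p + 1)"
      using L1(1) hp \<open>p > 0\<close> by (simp add: Lp_norm_powr)
    moreover have "\<epsilon>' * (\<integral>x. \<bar>h x\<bar> \<partial>M) \<le> \<epsilon> * Lp_norm M (p + 1) h"
    proof -
      have "\<epsilon>' * (\<integral>x. \<bar>h x\<bar> \<partial>M) \<le> \<epsilon>' * (K * Lp_norm M (p + 1) h)"
        using L1(2) \<epsilon>'(1) by (intro mult_left_mono) (simp_all add: K_def)
      also have "\<dots> \<le> \<epsilon> * Lp_norm M (p + 1) h"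
        using mult_right_mono[OF \<epsilon>'(2) Lp_norm_nonneg] by (simp add: mult.assoc)
      finally show ?thesis .
    qed
    ultimately have "\<bar>(\<integral>x. \<bar>f x + h x\<bar> powr (p + 1) / (p + 1) \<partial>M) - (\<integral>x. \<bar>f x\<bar> powr (p + 1) / (p + 1) \<partial>M)
        - (\<integral>x. odd_powr p (f x) * h x \<partial>M)\<bar> \<le> \<epsilon> * Lp_norm M (p + 1) h + C * Lp_norm M (p + 1) h powr (p + 1)"
      by linarith
    with int show ?thesis by blast
  qed
  with \<open>C \<ge> 0\<close> show ?thesis using that by blast
qed

text \<open>Since \<open>p > 0\<close>, the term \<open>C t\<^sup>p\<^sup>+\<^sup>1\<close> is at most \<open>\<epsilon> t / 2\<close> for small \<open>t \<ge> 0\<close>.\<close>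

lemma (in finite_measure) power_functional_differentiable:
  fixes f :: "'a \<Rightarrow> real"
  assumes "p > 0" "f \<in> borel_measurable M" "\<And>x. \<bar>f x\<bar> \<le> B" "\<epsilon> > 0"
  obtains \<delta> where "\<delta> > 0" "\<And>h. h \<in> Lp M (p + 1) \<Longrightarrow> Lp_norm M (p + 1) h < \<delta> \<Longrightarrow>
      \<bar>(\<integral>x. \<bar>f x + h x\<bar> powr (p + 1) / (p + 1) \<partial>M) - (\<integral>x. \<bar>f x\<bar> powr (p + 1) / (p + 1) \<partial>M)
        - (\<integral>x. odd_powr p (f x) * h x \<partial>M)\<bar> \<le> \<epsilon> * Lp_norm M (p + 1) h"
proof -
  have "\<epsilon> / 2 > 0" using \<open>\<epsilon> > 0\<close> by simp
  obtain C where "C \<ge> 0" "\<And>h. h \<in> Lp M (p + 1) \<Longrightarrow> integrable M (\<lambda>x. \<bar>f x + h x\<bar> powr (p + 1) / (p + 1))"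
    and C: "\<And>h. h \<in> Lp M (p + 1) \<Longrightarrow>
      \<bar>(\<integral>x. \<bar>f x + h x\<bar> powr (p + 1) / (p + 1) \<partial>M) - (\<integral>x. \<bar>f x\<bar> powr (p + 1) / (p + 1) \<partial>M)
        - (\<integral>x. odd_powr p (f x) * h x \<partial>M)\<bar> \<le> \<epsilon> / 2 * Lp_norm M (p + 1) h + C * Lp_norm M (p + 1) h powr (p + 1)"
    by (rule power_functional_remainder[OF assms(1-3) \<open>\<epsilon> / 2 > 0\<close>]) (rule that)
  define \<delta> where "\<delta> = (\<epsilon> / (2 * (C + 1))) powr (1 / p)"
  have "\<delta> > 0" using \<open>\<epsilon> > 0\<close> \<open>C \<ge> 0\<close> by (simp add: \<delta>_def)
  moreover have "\<epsilon> / 2 * t + C * t powr (p + 1) \<le> \<epsilon> * t" if "0 \<le> t" "t < \<delta>" for t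
  proof -
    have "t powr p \<le> \<delta> powr p" using that \<open>p > 0\<close> by (intro powr_mono2) auto
    also have "\<dots> = \<epsilon> / (2 * (C + 1))"
      using \<open>p > 0\<close> \<open>\<epsilon> > 0\<close> \<open>C \<ge> 0\<close> by (simp add: \<delta>_def powr_powr)
    finally have "C * t powr p \<le> C * (\<epsilon> / (2 * (C + 1)))"
      using \<open>C \<ge> 0\<close> by (rule mult_left_mono)
    also have "\<dots> \<le> \<epsilon> / 2"
      using \<open>\<epsilon> > 0\<close> \<open>C \<ge> 0\<close> by (simp add: field_simps)
    finally have "C * t powr p * t \<le> \<epsilon> / 2 * t" using that by (intro mult_right_mono) auto
    moreover have "t powr (p + 1) = t powr p * t"
      using that \<open>p > 0\<close> by (cases "t = 0") (auto simp: powr_add)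
    ultimately show ?thesis by (simp add: mult.assoc)
  qed
  ultimately show ?thesis
    by (intro that[of \<delta>] order_trans[OF C]) (simp_all add: Lp_norm_nonneg)
qed

text \<open>The constant of a continuous embedding may be taken positive, which allows dividing by it.\<close>

lemma continuous_embeddingE:
  assumes "continuous_embedding \<Omega> s r"
  obtains C where "C > 0" "\<And>u. u \<in> W1_0 \<Omega> s \<Longrightarrow> u \<in> Lp (lebesgue_on \<Omega>) r"
    "\<And>u. u \<in> W1_0 \<Omega> s \<Longrightarrow> Lp_norm (lebesgue_on \<Omega>) r u \<le> C * W1_norm \<Omega> s u"
proof -
  obtain C where C: "\<And>u. u \<in> W1_0 \<Omega> s \<Longrightarrow> Lp_norm (lebesgue_on \<Omega>) r u \<le> C * W1_norm \<Omega> s u"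
    using assms unfolding continuous_embedding_def by blast
  have "Lp_norm (lebesgue_on \<Omega>) r u \<le> max C 1 * W1_norm \<Omega> s u" if "u \<in> W1_0 \<Omega> s" for u
    using C[OF that] mult_right_mono[OF max.cobounded1 W1_norm_nonneg] by (rule order_trans)
  moreover have "u \<in> Lp (lebesgue_on \<Omega>) r" if "u \<in> W1_0 \<Omega> s" for u
    using assms that unfolding continuous_embedding_def by blast
  ultimately show ?thesis
    by (intro that[of "max C 1"]) auto
qed

definition G_derivative ::
  "'a::euclidean_space set \<Rightarrow> real \<Rightarrow> real \<Rightarrow> ('a \<Rightarrow> real) \<Rightarrow> ('a \<Rightarrow> real) \<Rightarrow>
    ('a \<Rightarrow> real) \<times> ('a \<Rightarrow> real) \<Rightarrow> real" where
  "G_derivative \<Omega> p q u v = (\<lambda>(h, k). dirichlet_form \<Omega> u k + dirichlet_form \<Omega> h v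
     - (\<integral>x. odd_powr p (u x) * h x \<partial>lebesgue_on \<Omega>) - (\<integral>x. odd_powr q (v x) * k x \<partial>lebesgue_on \<Omega>))"

text \<open>The remainder at an increment \<open>(h, k)\<close> is \<open>\<integral>\<nabla>h\<cdot>\<nabla>k\<close>, which is bounded by the product of the norms of
  \<open>h\<close> and \<open>k\<close>, minus the remainders of the two power terms. The latter are small relative to the Lebesgue
  norms of \<open>h\<close> and \<open>k\<close>, which the embeddings control by the Sobolev norms.\<close>

lemma G_functional_has_frechet_derivative:
  assumes "open \<Omega>" "bounded \<Omega>" "s > 1" "p > 0" "q > 0"
    and emb: "continuous_embedding \<Omega> s (p + 1)" "continuous_embedding \<Omega> (s / (s - 1)) (q + 1)"
    and u: "u \<in> test_functions \<Omega>" and v: "v \<in> test_functions \<Omega>"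
  shows "has_frechet_derivative_on (X_space \<Omega> s) (X_norm \<Omega> s) (G_functional \<Omega> p q) (u, v)
    (G_derivative \<Omega> p q u v)"
proof -
  interpret finite_measure "lebesgue_on \<Omega>"
    by (rule finite_measure_lebesgue_on_bounded_open) fact+
  define t where "t = s / (s - 1)"
  have "t > 1" using \<open>s > 1\<close> by (simp add: t_def)
  obtain C1 where C1: "C1 > 0" "\<And>h. h \<in> W1_0 \<Omega> s \<Longrightarrow> h \<in> Lp (lebesgue_on \<Omega>) (p + 1)"
    "\<And>h. h \<in> W1_0 \<Omega> s \<Longrightarrow> Lp_norm (lebesgue_on \<Omega>) (p + 1) h \<le> C1 * W1_norm \<Omega> s h"
    using emb(1) by (rule continuous_embeddingE) (rule that)
  obtain C2 where C2: "C2 > 0" "\<And>h. h \<in> W1_0 \<Omega> t \<Longrightarrow> h \<in> Lp (lebesgue_on \<Omega>) (q + 1)"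
    "\<And>h. h \<in> W1_0 \<Omega> t \<Longrightarrow> Lp_norm (lebesgue_on \<Omega>) (q + 1) h \<le> C2 * W1_norm \<Omega> t h"
    using emb(2)[folded t_def] by (rule continuous_embeddingE) (rule that)
  obtain Mu where Mu: "\<And>x. \<bar>u x\<bar> \<le> Mu" using test_function_bounded[OF u] by metis
  obtain Mv where Mv: "\<And>x. \<bar>v x\<bar> \<le> Mv" using test_function_bounded[OF v] by metis
  note um = test_function_measurable(1)[OF u, of \<Omega>] and vm = test_function_measurable(1)[OF v, of \<Omega>]
  have W: "h \<in> W1 \<Omega> r" if "h \<in> W1_0 \<Omega> r" for h r
    using that by (simp add: W1_0_def)
  have uW: "u \<in> W1 \<Omega> s" and vW: "v \<in> W1 \<Omega> t"
    using \<open>s > 1\<close> \<open>t > 1\<close> by (auto intro!: W test_function_in_W1_0 assms(1,2) u v)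
  note odd_p = odd_powr_mult_integral[OF \<open>p > 0\<close> um Mu]
  note odd_q = odd_powr_mult_integral[OF \<open>q > 0\<close> vm Mv]
  note bnd = dirichlet_form_bound(2)[OF \<open>open \<Omega>\<close> \<open>s > 1\<close>, folded t_def]
  note bil = dirichlet_form_bilinear[OF \<open>open \<Omega>\<close> \<open>s > 1\<close>, folded t_def]
  let ?a = "W1_norm \<Omega> s" and ?b = "W1_norm \<Omega> t"
  let ?Ip = "\<lambda>h. \<integral>x. odd_powr p (u x) * h x \<partial>lebesgue_on \<Omega>"
  let ?Iq = "\<lambda>k. \<integral>x. odd_powr q (v x) * k x \<partial>lebesgue_on \<Omega>"
  let ?Np = "\<lambda>h. \<integral>x. \<bar>h x\<bar> powr (p + 1) / (p + 1) \<partial>lebesgue_on \<Omega>"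
  let ?Nq = "\<lambda>k. \<integral>x. \<bar>k x\<bar> powr (q + 1) / (q + 1) \<partial>lebesgue_on \<Omega>"
  have X: "X_space \<Omega> s = W1_0 \<Omega> s \<times> W1_0 \<Omega> t" by (simp add: X_space_def t_def)
  have Xn: "X_norm \<Omega> s (h, k) = ?a h + ?b k" for h k by (simp add: X_norm_def t_def)
  have D: "G_derivative \<Omega> p q u v (h, k) = dirichlet_form \<Omega> u k + dirichlet_form \<Omega> h v - ?Ip h - ?Iq k" for h k
    by (simp add: G_derivative_def)
  show ?thesis
    unfolding has_frechet_derivative_on_def
  proof (intro conjI)
    have "G_derivative \<Omega> p q u v ((h, k) + (h', k')) = G_derivative \<Omega> p q u v (h, k) + G_derivative \<Omega> p q u v (h', k')"
      if "h \<in> W1_0 \<Omega> s" "k \<in> W1_0 \<Omega> t" "h' \<in> W1_0 \<Omega> s" "k' \<in> W1_0 \<Omega> t" for h k h' k'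
    proof -
      have "dirichlet_form \<Omega> u (k + k') = dirichlet_form \<Omega> u k + dirichlet_form \<Omega> u k'"
        using bil[OF uW uW that(2,4)[THEN W], of 1 0 1 1] by (simp add: plus_fun_def)
      moreover have "dirichlet_form \<Omega> (h + h') v = dirichlet_form \<Omega> h v + dirichlet_form \<Omega> h' v"
        using bil[OF that(1,3)[THEN W] vW vW, of 1 1 1 0] by (simp add: plus_fun_def)
      moreover have "?Ip (h + h') = ?Ip h + ?Ip h'"
        using odd_p(1)[OF C1(2)[OF that(1)]] odd_p(1)[OF C1(2)[OF that(3)]] by (simp add: distrib_left)
      moreover have "?Iq (k + k') = ?Iq k + ?Iq k'"
        using odd_q(1)[OF C2(2)[OF that(2)]] odd_q(1)[OF C2(2)[OF that(4)]] by (simp add: distrib_left)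
      ultimately show ?thesis unfolding add_Pair D by linarith
    qed
    then show "\<forall>h\<in>X_space \<Omega> s. \<forall>k\<in>X_space \<Omega> s.
        G_derivative \<Omega> p q u v (h + k) = G_derivative \<Omega> p q u v h + G_derivative \<Omega> p q u v k"
      unfolding X by blast
  next
    have "G_derivative \<Omega> p q u v (c *\<^sub>R (h, k)) = c * G_derivative \<Omega> p q u v (h, k)"
      if "h \<in> W1_0 \<Omega> s" "k \<in> W1_0 \<Omega> t" for h k c
    proof -
      have "dirichlet_form \<Omega> u (c *\<^sub>R k) = c * dirichlet_form \<Omega> u k"
        using bil[OF uW uW that(2,2)[THEN W], of 1 0 c 0] by (simp add: scaleR_fun_def)
      moreover have "dirichlet_form \<Omega> (c *\<^sub>R h) v = c * dirichlet_form \<Omega> h v"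
        using bil[OF that(1,1)[THEN W] vW vW, of c 0 1 0] by (simp add: scaleR_fun_def)
      moreover have "?Ip (c *\<^sub>R h) = c * ?Ip h" "?Iq (c *\<^sub>R k) = c * ?Iq k"
        by (simp_all add: scaleR_fun_def mult.left_commute)
      ultimately show ?thesis by (simp only: scaleR_Pair D right_diff_distrib distrib_left)
    qed
    then show "\<forall>c. \<forall>h\<in>X_space \<Omega> s. G_derivative \<Omega> p q u v (c *\<^sub>R h) = c * G_derivative \<Omega> p q u v h"
      unfolding X by blast
  next
    define Kp where "Kp = Mu powr p * measure (lebesgue_on \<Omega>) (space (lebesgue_on \<Omega>)) powr (1 - 1 / (p + 1))"
    define Kq where "Kq = Mv powr q * measure (lebesgue_on \<Omega>) (space (lebesgue_on \<Omega>)) powr (1 - 1 / (q + 1))"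
    have K: "Kp \<ge> 0" "Kq \<ge> 0" by (auto simp: Kp_def Kq_def)
    define C where "C = ?a u + ?b v + Kp * C1 + Kq * C2"
    have "\<bar>G_derivative \<Omega> p q u v (h, k)\<bar> \<le> C * X_norm \<Omega> s (h, k)"
      if hk: "h \<in> W1_0 \<Omega> s" "k \<in> W1_0 \<Omega> t" for h k
    proof -
      note nn = W1_norm_nonneg[of \<Omega> s h] W1_norm_nonneg[of \<Omega> t k] W1_norm_nonneg[of \<Omega> s u] W1_norm_nonneg[of \<Omega> t v]
      have "\<bar>?Ip h\<bar> \<le> Kp * (C1 * ?a h)"
        using odd_p(2)[OF C1(2)[OF hk(1)], folded Kp_def] mult_left_mono[OF C1(3)[OF hk(1)] K(1)] by linarith
      moreover have "\<bar>?Iq k\<bar> \<le> Kq * (C2 * ?b k)"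
        using odd_q(2)[OF C2(2)[OF hk(2)], folded Kq_def] mult_left_mono[OF C2(3)[OF hk(2)] K(2)] by linarith
      ultimately have "\<bar>G_derivative \<Omega> p q u v (h, k)\<bar> \<le> ?a u * ?b k + ?a h * ?b v + Kp * (C1 * ?a h) + Kq * (C2 * ?b k)"
        unfolding D using bnd[OF uW W[OF hk(2)]] bnd[OF W[OF hk(1)] vW] by linarith
      also have "\<dots> \<le> C * X_norm \<Omega> s (h, k)"
        using nn K C1(1) C2(1) by (simp add: C_def Xn algebra_simps)
      finally show ?thesis .
    qed
    then show "\<exists>C. \<forall>h\<in>X_space \<Omega> s. \<bar>G_derivative \<Omega> p q u v h\<bar> \<le> C * X_norm \<Omega> s h"
      unfolding X by blast
  next
    show "\<forall>\<epsilon>>0. \<exists>\<delta>>0. \<forall>h\<in>X_space \<Omega> s. X_norm \<Omega> s h < \<delta> \<longrightarrow>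
      \<bar>G_functional \<Omega> p q ((u, v) + h) - G_functional \<Omega> p q (u, v) - G_derivative \<Omega> p q u v h\<bar> \<le> \<epsilon> * X_norm \<Omega> s h"
    proof (intro allI impI)
      fix \<epsilon> :: real assume "\<epsilon> > 0"
      have \<epsilon>12: "\<epsilon> / (2 * C1) > 0" "\<epsilon> / (2 * C2) > 0" using \<open>\<epsilon> > 0\<close> C1(1) C2(1) by auto
      obtain \<delta>1 where \<delta>1: "\<delta>1 > 0" "\<And>h. h \<in> Lp (lebesgue_on \<Omega>) (p + 1) \<Longrightarrow> Lp_norm (lebesgue_on \<Omega>) (p + 1) h < \<delta>1 \<Longrightarrow>
        \<bar>(\<integral>x. \<bar>u x + h x\<bar> powr (p + 1) / (p + 1) \<partial>lebesgue_on \<Omega>) - ?Np u - ?Ip h\<bar> \<le> \<epsilon> / (2 * C1) * Lp_norm (lebesgue_on \<Omega>) (p + 1) h"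
        by (rule power_functional_differentiable[OF \<open>p > 0\<close> um Mu \<epsilon>12(1)]) (rule that)
      obtain \<delta>2 where \<delta>2: "\<delta>2 > 0" "\<And>h. h \<in> Lp (lebesgue_on \<Omega>) (q + 1) \<Longrightarrow> Lp_norm (lebesgue_on \<Omega>) (q + 1) h < \<delta>2 \<Longrightarrow>
        \<bar>(\<integral>x. \<bar>v x + h x\<bar> powr (q + 1) / (q + 1) \<partial>lebesgue_on \<Omega>) - ?Nq v - ?Iq h\<bar> \<le> \<epsilon> / (2 * C2) * Lp_norm (lebesgue_on \<Omega>) (q + 1) h"
        by (rule power_functional_differentiable[OF \<open>q > 0\<close> vm Mv \<epsilon>12(2)]) (rule that)
      have intp: "integrable (lebesgue_on \<Omega>) (\<lambda>x. \<bar>u x + h x\<bar> powr (p + 1) / (p + 1))"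
        if "h \<in> Lp (lebesgue_on \<Omega>) (p + 1)" for h
      proof (rule power_functional_remainder[OF \<open>p > 0\<close> um Mu \<open>\<epsilon> > 0\<close>])
        assume "\<And>h. h \<in> Lp (lebesgue_on \<Omega>) (p + 1) \<Longrightarrow>
          integrable (lebesgue_on \<Omega>) (\<lambda>x. \<bar>u x + h x\<bar> powr (p + 1) / (p + 1))"
        with that show ?thesis by simp
      qed
      have intq: "integrable (lebesgue_on \<Omega>) (\<lambda>x. \<bar>v x + h x\<bar> powr (q + 1) / (q + 1))"
        if "h \<in> Lp (lebesgue_on \<Omega>) (q + 1)" for h
      proof (rule power_functional_remainder[OF \<open>q > 0\<close> vm Mv \<open>\<epsilon> > 0\<close>])
        assume "\<And>h. h \<in> Lp (lebesgue_on \<Omega>) (q + 1) \<Longrightarrow>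
          integrable (lebesgue_on \<Omega>) (\<lambda>x. \<bar>v x + h x\<bar> powr (q + 1) / (q + 1))"
        with that show ?thesis by simp
      qed
      define \<delta> where "\<delta> = min (\<epsilon> / 2) (min (\<delta>1 / C1) (\<delta>2 / C2))"
      have "\<delta> > 0" using \<open>\<epsilon> > 0\<close> \<delta>1(1) \<delta>2(1) C1(1) C2(1) by (simp add: \<delta>_def)
      have "\<bar>G_functional \<Omega> p q ((u, v) + (h, k)) - G_functional \<Omega> p q (u, v) - G_derivative \<Omega> p q u v (h, k)\<bar>
          \<le> \<epsilon> * X_norm \<Omega> s (h, k)"
        if hk: "h \<in> W1_0 \<Omega> s" "k \<in> W1_0 \<Omega> t" and small: "X_norm \<Omega> s (h, k) < \<delta>" for h k
      proof -
        note nn = W1_norm_nonneg[of \<Omega> s h] W1_norm_nonneg[of \<Omega> t k]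
        note hL = C1(2)[OF hk(1)] and kL = C2(2)[OF hk(2)]
        have sm: "?a h + ?b k < \<epsilon> / 2" "?a h < \<delta>1 / C1" "?b k < \<delta>2 / C2"
          using small nn by (auto simp: Xn \<delta>_def)
        then have "C1 * ?a h < \<delta>1" "C2 * ?b k < \<delta>2"
          using C1(1) C2(1) by (auto simp: field_simps)
        then have lt: "Lp_norm (lebesgue_on \<Omega>) (p + 1) h < \<delta>1" "Lp_norm (lebesgue_on \<Omega>) (q + 1) k < \<delta>2"
          using C1(3)[OF hk(1)] C2(3)[OF hk(2)] by linarith+
        have zero: "(\<lambda>x. 0) \<in> Lp (lebesgue_on \<Omega>) r" for r
          by (simp add: Lp_def)
        have G: "G_functional \<Omega> p q (f, g) = dirichlet_form \<Omega> f g - (?Np f + ?Nq g)"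
          if "integrable (lebesgue_on \<Omega>) (\<lambda>x. \<bar>f x\<bar> powr (p + 1) / (p + 1))"
            "integrable (lebesgue_on \<Omega>) (\<lambda>x. \<bar>g x\<bar> powr (q + 1) / (q + 1))" for f g
          using Bochner_Integration.integral_add[OF that] by (simp add: G_functional_def dirichlet_form_def)
        have G0: "G_functional \<Omega> p q (u, v) = dirichlet_form \<Omega> u v - (?Np u + ?Nq v)"
          using intp[OF zero] intq[OF zero] by (intro G) simp_all
        have G1: "G_functional \<Omega> p q (u + h, v + k) = dirichlet_form \<Omega> (u + h) (v + k)
          - ((\<integral>x. \<bar>u x + h x\<bar> powr (p + 1) / (p + 1) \<partial>lebesgue_on \<Omega>) + (\<integral>x. \<bar>v x + k x\<bar> powr (q + 1) / (q + 1) \<partial>lebesgue_on \<Omega>))"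
          using intp[OF hL] intq[OF kL] G[of "u + h" "v + k"] by simp
        have E: "dirichlet_form \<Omega> (u + h) (v + k) = dirichlet_form \<Omega> u v + dirichlet_form \<Omega> u k
          + dirichlet_form \<Omega> h v + dirichlet_form \<Omega> h k"
          using bil[OF uW W[OF hk(1)] vW W[OF hk(2)], of 1 1 1 1] by (simp add: plus_fun_def)
        have "\<bar>dirichlet_form \<Omega> h k\<bar> \<le> ?a h * ?b k" by (rule bnd[OF hk[THEN W]])
        also have "\<dots> \<le> (\<epsilon> / 2) * ?b k" using sm nn by (intro mult_right_mono) auto
        finally have r0: "\<bar>dirichlet_form \<Omega> h k\<bar> \<le> (\<epsilon> / 2) * ?b k" .
        have "\<epsilon> / (2 * C1) * Lp_norm (lebesgue_on \<Omega>) (p + 1) h \<le> \<epsilon> / (2 * C1) * (C1 * ?a h)"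
          using \<epsilon>12 C1(3)[OF hk(1)] by (intro mult_left_mono) auto
        also have "\<dots> = (\<epsilon> / 2) * ?a h" using C1(1) by simp
        finally have r1: "\<bar>(\<integral>x. \<bar>u x + h x\<bar> powr (p + 1) / (p + 1) \<partial>lebesgue_on \<Omega>) - ?Np u - ?Ip h\<bar> \<le> (\<epsilon> / 2) * ?a h"
          using \<delta>1(2)[OF hL lt(1)] by linarith
        have "\<epsilon> / (2 * C2) * Lp_norm (lebesgue_on \<Omega>) (q + 1) k \<le> \<epsilon> / (2 * C2) * (C2 * ?b k)"
          using \<epsilon>12 C2(3)[OF hk(2)] by (intro mult_left_mono) auto
        also have "\<dots> = (\<epsilon> / 2) * ?b k" using C2(1) by simp
        finally have r2: "\<bar>(\<integral>x. \<bar>v x + k x\<bar> powr (q + 1) / (q + 1) \<partial>lebesgue_on \<Omega>) - ?Nq v - ?Iq k\<bar> \<le> (\<epsilon> / 2) * ?b k"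
          using \<delta>2(2)[OF kL lt(2)] by linarith
        have "0 \<le> \<epsilon> / 2 * ?a h" using \<open>\<epsilon> > 0\<close> nn by simp
        moreover have "\<epsilon> * X_norm \<Omega> s (h, k) = \<epsilon> / 2 * ?a h + \<epsilon> / 2 * ?a h + \<epsilon> / 2 * ?b k + \<epsilon> / 2 * ?b k"
          by (simp add: Xn field_simps)
        ultimately show ?thesis
          using r0 r1 r2 unfolding add_Pair G0 G1 E D by linarith
      qed
      then show "\<exists>\<delta>>0. \<forall>h\<in>X_space \<Omega> s. X_norm \<Omega> s h < \<delta> \<longrightarrow>
        \<bar>G_functional \<Omega> p q ((u, v) + h) - G_functional \<Omega> p q (u, v) - G_derivative \<Omega> p q u v h\<bar> \<le> \<epsilon> * X_norm \<Omega> s h"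
        using \<open>\<delta> > 0\<close> unfolding X by (intro exI[of _ \<delta>] conjI) auto
    qed
  qed
qed

section \<open>Small points of the Nehari set\<close>

text \<open>The points of \<open>\<Omega>\<close> where \<open>f\<close> is positive form a nonempty open set, which is not a null set.\<close>

lemma integral_pos_of_continuous:
  fixes f :: "'a::euclidean_space \<Rightarrow> real"
  assumes "open \<Omega>" "continuous_on UNIV f" "integrable (lebesgue_on \<Omega>) f" "\<And>x. f x \<ge> 0"
    and "x\<^sub>0 \<in> \<Omega>" "f x\<^sub>0 \<noteq> 0"
  shows "(\<integral>x. f x \<partial>lebesgue_on \<Omega>) > 0"
proof (rule ccontr)
  assume "\<not> ?thesis"
  moreover have "(\<integral>x. f x \<partial>lebesgue_on \<Omega>) \<ge> 0" by (simp add: assms(4))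
  ultimately have "(\<integral>x. f x \<partial>lebesgue_on \<Omega>) = 0" by linarith
  then have "AE x in lebesgue_on \<Omega>. f x = 0"
    using integral_nonneg_eq_0_iff_AE[OF assms(3)] assms(4) by simp
  then have ae: "AE x in lebesgue. x \<notin> {x. f x \<noteq> 0} \<inter> \<Omega>"
    using \<open>open \<Omega>\<close> by (auto simp: AE_restrict_space_iff elim: eventually_mono)
  have op: "open ({x. f x \<noteq> 0} \<inter> \<Omega>)"
    using assms(1,2) by (intro open_Int open_Collect_neq continuous_on_const)
  then have "{x. f x \<noteq> 0} \<inter> \<Omega> \<in> null_sets lebesgue"
    using ae by (subst AE_iff_null_sets) auto
  then have "negligible ({x. f x \<noteq> 0} \<inter> \<Omega>)"
    by (simp add: negligible_iff_null_sets)
  then show False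
    using open_not_negligible[OF op] assms(5,6) by blast
qed

text \<open>A test function with vanishing gradient is constant, and a nonzero constant does not have compact
  support.\<close>

lemma test_function_dirichlet_pos:
  assumes "open \<Omega>" "bounded \<Omega>" and \<phi>: "\<phi> \<in> test_functions \<Omega>" and "\<phi> x\<^sub>0 \<noteq> 0"
  shows "(\<integral>x. grad \<phi> x \<bullet> grad \<phi> x \<partial>lebesgue_on \<Omega>) > 0"
proof -
  have "\<exists>x. grad \<phi> x \<noteq> 0"
  proof (rule ccontr)
    assume "\<not> ?thesis"
    then have "frechet_derivative \<phi> (at x) b = 0" if "b \<in> Basis" for x b
      using grad_inner_Basis[OF that, of \<phi> x] by simp
    then have "frechet_derivative \<phi> (at x) = (\<lambda>h. 0)" for x
      by (intro linear_eq_stdbasis has_derivative_linear[OF test_function_has_derivative[OF \<phi>]] linear_zero) simp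
    then have "\<And>x. (\<phi> has_derivative (\<lambda>h. 0)) (at x)"
      using test_function_has_derivative[OF \<phi>] by metis
    then obtain c where "\<And>x. \<phi> x = c"
      using has_derivative_zero_constant[of UNIV \<phi>] by auto
    then have "closure {x. \<phi> x \<noteq> 0} = UNIV" using \<open>\<phi> x\<^sub>0 \<noteq> 0\<close> by simp
    moreover have "compact (closure {x. \<phi> x \<noteq> 0})"
      using \<phi> by (simp add: test_functions_def)
    ultimately show False
      using compact_imp_bounded not_bounded_UNIV by metis
  qed
  then obtain x where x: "grad \<phi> x \<noteq> 0" by blast
  then have "x \<in> \<Omega>"
    using grad_eq_0_outside_support[of x \<phi>] \<phi> by (auto simp: test_functions_def)
  show ?thesis
  proof (rule integral_pos_of_continuous[OF \<open>open \<Omega>\<close> _ _ _ \<open>x \<in> \<Omega>\<close>])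
    show "continuous_on UNIV (\<lambda>x. grad \<phi> x \<bullet> grad \<phi> x)"
      using grad_continuous[OF \<phi>] by (intro continuous_intros)
    have "grad \<phi> \<in> Lp (lebesgue_on \<Omega>) 2"
      by (rule test_function_in_Lp(2)[OF assms(1,2) \<phi>]) simp
    then show "integrable (lebesgue_on \<Omega>) (\<lambda>x. grad \<phi> x \<bullet> grad \<phi> x)"
      by (simp add: Lp_def power2_norm_eq_inner)
  qed (use x in auto)
qed

lemma nonzero_test_function_exists:
  assumes "open U" "x \<in> U"
  obtains \<phi> where "\<phi> \<in> test_functions U" "\<phi> x \<noteq> 0"
proof -
  obtain a c where "cbox a c \<subseteq> U" "x \<in> box a c"
    using open_contains_cbox[OF assms] by metis
  then show ?thesis
    using that[of "box_bump a c 0"] by (simp add: box_bump_in_test_functions box_bump_eq_0_iff)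
qed

lemma dirichlet_form_test_functions:
  assumes "open \<Omega>" "u \<in> test_functions \<Omega>" "v \<in> test_functions \<Omega>"
  shows "dirichlet_form \<Omega> u v = (\<integral>x. grad u x \<bullet> grad v x \<partial>lebesgue_on \<Omega>)"
  unfolding dirichlet_form_def
proof (rule integral_cong_AE)
  show "AE x in lebesgue_on \<Omega>. weak_grad \<Omega> u x \<bullet> weak_grad \<Omega> v x = grad u x \<bullet> grad v x"
    using weak_grad_test_function(1)[OF assms(1,2)] weak_grad_test_function(1)[OF assms(1,3)]
    by eventually_elim simp
  note [measurable] = weak_grad_test_function(2)[OF assms(1,2)] weak_grad_test_function(2)[OF assms(1,3)]
    test_function_measurable(2)[OF assms(2)] test_function_measurable(2)[OF assms(3)]
  show "(\<lambda>x. weak_grad \<Omega> u x \<bullet> weak_grad \<Omega> v x) \<in> borel_measurable (lebesgue_on \<Omega>)"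
    "(\<lambda>x. grad u x \<bullet> grad v x) \<in> borel_measurable (lebesgue_on \<Omega>)"
    by measurable
qed

text \<open>The derivative at \<open>(u, v)\<close> in the direction \<open>(u, v)\<close> is twice the gradient integral minus the two
  power integrals. Positivity of one of these excludes the zero element.\<close>

lemma test_functions_in_nehariI:
  assumes "open \<Omega>" "bounded \<Omega>" "s > 1" "p > 0" "q > 0"
    and "continuous_embedding \<Omega> s (p + 1)" "continuous_embedding \<Omega> (s / (s - 1)) (q + 1)"
    and u: "u \<in> test_functions \<Omega>" and v: "v \<in> test_functions \<Omega>"
    and eq: "2 * (\<integral>x. grad u x \<bullet> grad v x \<partial>lebesgue_on \<Omega>) =
      (\<integral>x. \<bar>u x\<bar> powr (p + 1) \<partial>lebesgue_on \<Omega>) + (\<integral>x. \<bar>v x\<bar> powr (q + 1) \<partial>lebesgue_on \<Omega>)"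
    and pos: "(\<integral>x. \<bar>u x\<bar> powr (p + 1) \<partial>lebesgue_on \<Omega>) > 0"
  shows "(u, v) \<in> nehari \<Omega> s p q"
proof -
  have "(u, v) \<in> X_space \<Omega> s"
    using assms by (auto simp: X_space_def intro!: test_function_in_W1_0)
  moreover have "\<not> (AE x in lebesgue_on \<Omega>. u x = 0 \<and> v x = 0)"
  proof
    assume "AE x in lebesgue_on \<Omega>. u x = 0 \<and> v x = 0"
    then have "AE x in lebesgue_on \<Omega>. \<bar>u x\<bar> powr (p + 1) = 0"
      by eventually_elim simp
    then show False using pos integral_eq_zero_AE by fastforce
  qed
  moreover have "G_derivative \<Omega> p q u v (u, v) = 0"
    using eq by (simp add: G_derivative_def odd_powr_mult_self dirichlet_form_test_functions[OF assms(1) u v])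
  ultimately show ?thesis
    using G_functional_has_frechet_derivative[OF assms(1-9)] unfolding nehari_def by blast
qed

lemma test_function_powr_integral_pos:
  assumes "open \<Omega>" "bounded \<Omega>" and \<phi>: "\<phi> \<in> test_functions \<Omega>" and "x\<^sub>0 \<in> \<Omega>" "\<phi> x\<^sub>0 \<noteq> 0" "r > 0"
  shows "(\<integral>x. \<bar>\<phi> x\<bar> powr r \<partial>lebesgue_on \<Omega>) > 0"
proof (rule integral_pos_of_continuous[OF \<open>open \<Omega>\<close> _ _ _ \<open>x\<^sub>0 \<in> \<Omega>\<close>])
  show "continuous_on UNIV (\<lambda>x. \<bar>\<phi> x\<bar> powr r)"
    using test_function_continuous[OF \<phi>] \<open>r > 0\<close>
    by (intro continuous_on_powr' continuous_intros) auto
  have "\<phi> \<in> Lp (lebesgue_on \<Omega>) r"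
    by (rule test_function_in_Lp(1)[OF assms(1,2) \<phi>]) (use \<open>r > 0\<close> in simp)
  then show "integrable (lebesgue_on \<Omega>) (\<lambda>x. \<bar>\<phi> x\<bar> powr r)"
    by (simp add: Lp_def)
qed (use assms in auto)

text \<open>The Nehari points are \<open>(a \<phi>, \<kappa> a\<^sup>p \<phi>)\<close> with \<open>\<kappa> = A / (2 D) + \<delta>\<close> and \<open>\<delta>\<close> small. Norm and value
  are estimated by explicit functions of \<open>\<delta>\<close> that tend to zero.\<close>

lemma small_nehari_point:
  fixes \<Omega> :: "'a::euclidean_space set"
  assumes "open \<Omega>" "\<Omega> \<noteq> {}" "bounded \<Omega>" "s > 1" "p > 0" "q > 0" "p * q > 1"
    and "continuous_embedding \<Omega> s (p + 1)" "continuous_embedding \<Omega> (s / (s - 1)) (q + 1)"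
    and "\<eta> > 0"
  obtains w where "w \<in> nehari \<Omega> s p q" "X_norm \<Omega> s w < \<eta>" "G_functional \<Omega> p q w < \<eta>"
proof -
  obtain x\<^sub>0 where x\<^sub>0: "x\<^sub>0 \<in> \<Omega>" using \<open>\<Omega> \<noteq> {}\<close> by blast
  obtain \<phi> where \<phi>: "\<phi> \<in> test_functions \<Omega>" "\<phi> x\<^sub>0 \<noteq> 0"
    by (rule nonzero_test_function_exists[OF \<open>open \<Omega>\<close> x\<^sub>0]) (rule that)
  obtain M where M: "M \<ge> 0" "\<And>x. \<bar>\<phi> x\<bar> \<le> M" "\<And>x. norm (grad \<phi> x) \<le> M"
    by (rule test_function_bounded[OF \<phi>(1)]) (rule that)
  define D where "D = (\<integral>x. grad \<phi> x \<bullet> grad \<phi> x \<partial>lebesgue_on \<Omega>)"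
  define A where "A = (\<integral>x. \<bar>\<phi> x\<bar> powr (p + 1) \<partial>lebesgue_on \<Omega>)"
  define B where "B = (\<integral>x. \<bar>\<phi> x\<bar> powr (q + 1) \<partial>lebesgue_on \<Omega>)"
  have "D > 0"
    unfolding D_def by (rule test_function_dirichlet_pos[OF assms(1,3) \<phi>])
  have "A > 0" "B > 0"
    unfolding A_def B_def
    by (rule test_function_powr_integral_pos[OF assms(1,3) \<phi>(1) x\<^sub>0 \<phi>(2)]; use assms(5,6) in simp)+
  \<comment> \<open>For \<open>(a \<phi>, \<kappa> a\<^sup>p \<phi>)\<close> the Nehari equation divided by \<open>a\<^sup>p\<^sup>+\<^sup>1\<close> is
    \<open>2 \<kappa> D = A + \<kappa>\<^sup>q\<^sup>+\<^sup>1 a\<^sup>p\<^sup>q\<^sup>-\<^sup>1 B\<close>; with \<open>2 \<kappa> D - A = 2 D \<delta>\<close> it determines \<open>a\<close>.\<close>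
  define \<kappa> where "\<kappa> \<delta> = A / (2 * D) + \<delta>" for \<delta>
  define a where "a \<delta> = (2 * D * \<delta> / (\<kappa> \<delta> powr (q + 1) * B)) powr (1 / (p * q - 1))" for \<delta>
  define m1 m2 where "m1 = M * (2 * measure lebesgue \<Omega> powr (1 / s))"
    and "m2 = M * (2 * measure lebesgue \<Omega> powr (1 / (s / (s - 1))))"
  have \<kappa>_lim: "(\<kappa> \<longlongrightarrow> A / (2 * D)) (at_right 0)"
    unfolding \<kappa>_def by (auto intro!: tendsto_eq_intros)
  have a_lim: "(a \<longlongrightarrow> 0) (at_right 0)"
  proof -
    have "((\<lambda>\<delta>. 2 * D * \<delta> / (\<kappa> \<delta> powr (q + 1) * B)) \<longlongrightarrow> 2 * D * 0 / ((A / (2 * D)) powr (q + 1) * B)) (at_right 0)"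
      using \<open>A > 0\<close> \<open>B > 0\<close> \<open>D > 0\<close> by (intro tendsto_intros \<kappa>_lim) auto
    then have "((\<lambda>\<delta>. 2 * D * \<delta> / (\<kappa> \<delta> powr (q + 1) * B)) \<longlongrightarrow> 0) (at_right 0)" by simp
    moreover have "\<forall>\<^sub>F \<delta> in at_right 0. 0 \<le> 2 * D * \<delta> / (\<kappa> \<delta> powr (q + 1) * B)"
      using \<open>B > 0\<close> \<open>D > 0\<close> by (auto simp: eventually_at_filter)
    ultimately show ?thesis
      unfolding a_def
      using tendsto_powr'[of "\<lambda>\<delta>. 2 * D * \<delta> / (\<kappa> \<delta> powr (q + 1) * B)" 0 "at_right 0" "\<lambda>_. 1 / (p * q - 1)"
          "1 / (p * q - 1)"] \<open>p * q > 1\<close> by simp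
  qed
  have a_powr_lim: "((\<lambda>\<delta>. a \<delta> powr \<gamma>) \<longlongrightarrow> 0) (at_right 0)" if "\<gamma> > 0" for \<gamma>
    using tendsto_powr'[OF a_lim tendsto_const[of \<gamma>]] that by (simp add: a_def)
  have "((\<lambda>\<delta>. a \<delta> * m1 + \<kappa> \<delta> * a \<delta> powr p * m2) \<longlongrightarrow> 0 * m1 + A / (2 * D) * 0 * m2) (at_right 0)"
    by (intro tendsto_intros a_lim \<kappa>_lim a_powr_lim \<open>p > 0\<close>)
  then have N: "\<forall>\<^sub>F \<delta> in at_right 0. a \<delta> * m1 + \<kappa> \<delta> * a \<delta> powr p * m2 < \<eta>"
    using \<open>\<eta> > 0\<close> by (simp add: order_tendstoD)
  have "((\<lambda>\<delta>. \<kappa> \<delta> * a \<delta> powr (p + 1) * D) \<longlongrightarrow> A / (2 * D) * 0 * D) (at_right 0)"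
    using \<open>p > 0\<close> by (intro tendsto_intros \<kappa>_lim a_powr_lim) auto
  then have G: "\<forall>\<^sub>F \<delta> in at_right 0. \<kappa> \<delta> * a \<delta> powr (p + 1) * D < \<eta>"
    using \<open>\<eta> > 0\<close> by (simp add: order_tendstoD)
  have "\<forall>\<^sub>F \<delta> in at_right (0::real). 0 < \<delta>"
    by (simp add: eventually_at_filter)
  then obtain \<delta> where \<delta>: "0 < \<delta>" "a \<delta> * m1 + \<kappa> \<delta> * a \<delta> powr p * m2 < \<eta>"
    "\<kappa> \<delta> * a \<delta> powr (p + 1) * D < \<eta>"
    using eventually_happens[OF eventually_conj[OF eventually_conj[OF N G]]] by auto
  define \<alpha> c where "\<alpha> = a \<delta>" and "c = \<kappa> \<delta> * \<alpha> powr p"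
  have "\<kappa> \<delta> > 0" using \<open>A > 0\<close> \<open>D > 0\<close> \<delta>(1) by (simp add: \<kappa>_def add_pos_pos)
  then have "\<alpha> > 0" "c > 0"
    using \<open>B > 0\<close> \<open>D > 0\<close> \<delta>(1) by (simp_all add: \<alpha>_def a_def c_def)
  have ac: "\<alpha> * c = \<kappa> \<delta> * \<alpha> powr (p + 1)"
    using \<open>\<alpha> > 0\<close> by (simp add: c_def powr_add)
  have eq: "2 * (\<alpha> * c * D) = \<alpha> powr (p + 1) * A + c powr (q + 1) * B"
  proof -
    have "\<alpha> powr (p * q - 1) = 2 * D * \<delta> / (\<kappa> \<delta> powr (q + 1) * B)"
      using \<open>p * q > 1\<close> \<open>\<kappa> \<delta> > 0\<close> \<open>B > 0\<close> \<open>D > 0\<close> \<delta>(1) by (simp add: \<alpha>_def a_def powr_powr)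
    then have "\<kappa> \<delta> powr (q + 1) * \<alpha> powr (p * q - 1) * B = 2 * D * \<delta>"
      using \<open>\<kappa> \<delta> > 0\<close> \<open>B > 0\<close> by simp
    moreover have "c powr (q + 1) = \<kappa> \<delta> powr (q + 1) * \<alpha> powr (p * q - 1) * \<alpha> powr (p + 1)"
    proof -
      have "p * (q + 1) = (p * q - 1) + (p + 1)" by (simp add: algebra_simps)
      then have "(\<alpha> powr p) powr (q + 1) = \<alpha> powr (p * q - 1) * \<alpha> powr (p + 1)"
        by (simp only: powr_powr flip: powr_add)
      then show ?thesis
        using \<open>\<kappa> \<delta> > 0\<close> by (simp add: c_def powr_mult)
    qed
    ultimately have "c powr (q + 1) * B = 2 * D * \<delta> * \<alpha> powr (p + 1)"
      by (simp add: mult_ac)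
    then show ?thesis
      unfolding ac using \<open>D > 0\<close> by (simp add: \<kappa>_def field_simps)
  qed
  define u v where "u = (\<lambda>x. \<alpha> * \<phi> x)" and "v = (\<lambda>x. c * \<phi> x)"
  have u: "u \<in> test_functions \<Omega>" and v: "v \<in> test_functions \<Omega>"
    unfolding u_def v_def by (rule test_functions_scale[OF \<phi>(1)])+
  have gu: "grad u x = \<alpha> *\<^sub>R grad \<phi> x" and gv: "grad v x = c *\<^sub>R grad \<phi> x" for x
    unfolding u_def v_def by (rule grad_scale[OF \<phi>(1)])+
  have uv: "(\<integral>x. grad u x \<bullet> grad v x \<partial>lebesgue_on \<Omega>) = \<alpha> * c * D"
    by (simp add: gu gv D_def mult.assoc)
  have Iu: "(\<integral>x. \<bar>u x\<bar> powr (p + 1) \<partial>lebesgue_on \<Omega>) = \<alpha> powr (p + 1) * A"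
    using \<open>\<alpha> > 0\<close> by (simp add: u_def A_def abs_mult powr_mult)
  have Iv: "(\<integral>x. \<bar>v x\<bar> powr (q + 1) \<partial>lebesgue_on \<Omega>) = c powr (q + 1) * B"
    using \<open>c > 0\<close> by (simp add: v_def B_def abs_mult powr_mult)
  have mem: "(u, v) \<in> nehari \<Omega> s p q"
    by (rule test_functions_in_nehariI[OF assms(1,3,4,5,6,8,9) u v])
      (use eq \<open>\<alpha> > 0\<close> \<open>A > 0\<close> in \<open>simp_all add: uv Iu Iv\<close>)
  have "W1_norm \<Omega> s u \<le> (\<alpha> * M) * (2 * measure lebesgue \<Omega> powr (1 / s))"
  proof (rule W1_norm_test_function_le[OF assms(1,3) u])
    show "\<bar>u x\<bar> \<le> \<alpha> * M" for x
      using \<open>\<alpha> > 0\<close> M(2) by (simp add: u_def abs_mult)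
    show "norm (grad u x) \<le> \<alpha> * M" for x
      using \<open>\<alpha> > 0\<close> M(3) by (simp add: gu)
  qed (use \<open>s > 1\<close> in simp)
  moreover have "W1_norm \<Omega> (s / (s - 1)) v \<le> (c * M) * (2 * measure lebesgue \<Omega> powr (1 / (s / (s - 1))))"
  proof (rule W1_norm_test_function_le[OF assms(1,3) v])
    show "\<bar>v x\<bar> \<le> c * M" for x
      using \<open>c > 0\<close> M(2) by (simp add: v_def abs_mult)
    show "norm (grad v x) \<le> c * M" for x
      using \<open>c > 0\<close> M(3) by (simp add: gv)
  qed (use \<open>s > 1\<close> in simp)
  ultimately have "X_norm \<Omega> s (u, v) \<le> \<alpha> * m1 + c * m2"
    by (simp only: X_norm_def m1_def m2_def prod.case mult.assoc)
  also have "\<dots> < \<eta>"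
    using \<delta>(2) by (simp add: \<alpha>_def c_def)
  finally have "X_norm \<Omega> s (u, v) < \<eta>" .
  moreover have "G_functional \<Omega> p q (u, v) < \<eta>"
  proof -
    have "G_functional \<Omega> p q (u, v) \<le> dirichlet_form \<Omega> u v"
      using \<open>p > 0\<close> \<open>q > 0\<close> by (simp add: G_functional_def dirichlet_form_def)
    also have "\<dots> = \<kappa> \<delta> * \<alpha> powr (p + 1) * D"
      by (simp add: dirichlet_form_test_functions[OF assms(1) u v] uv ac)
    also have "\<dots> < \<eta>" using \<delta>(3) by (simp add: \<alpha>_def)
    finally show ?thesis .
  qed
  ultimately show ?thesis using that mem by blast
qed

theorem proposition2p1:
  fixes \<Omega> :: "'a::euclidean_space set" and p q s :: real
  assumes "open \<Omega>" and "connected \<Omega>" and "\<Omega> \<noteq> {}" and "bounded \<Omega>"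
    and "p > 0" and "q > 0"
    and "1 / (p + 1) + 1 / (q + 1) > (real DIM('a) - 2) / real DIM('a)"
    and "p * q > 1"
    and "s > 1"
    and "continuous_embedding \<Omega> s (p + 1)" and "compact_embedding \<Omega> s (p + 1)"
    and "continuous_embedding \<Omega> (s / (s - 1)) (q + 1)"
    and "compact_embedding \<Omega> (s / (s - 1)) (q + 1)"
  shows "(0, 0) \<in> closure_on (X_space \<Omega> s) (X_norm \<Omega> s) (nehari \<Omega> s p q) \<and>
    (INF w\<in>nehari \<Omega> s p q. ereal (G_functional \<Omega> p q w)) \<le> 0"
proof
  note small = small_nehari_point[OF assms(1,3,4,9,5,6,8,10,12)]
  have "(0, 0) \<in> X_space \<Omega> s"
    using assms(9) by (auto simp: X_space_def intro!: test_function_in_W1_0 assms(1,4) zero_in_test_functions)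
  moreover have "\<exists>z\<in>nehari \<Omega> s p q. X_norm \<Omega> s (z - (0, 0)) < \<epsilon>" if "\<epsilon> > 0" for \<epsilon>
  proof (rule small[OF that])
    fix w assume "w \<in> nehari \<Omega> s p q" "X_norm \<Omega> s w < \<epsilon>"
    moreover have "w - (0, 0) = w" by (cases w) simp
    ultimately show ?thesis by metis
  qed
  ultimately show "(0, 0) \<in> closure_on (X_space \<Omega> s) (X_norm \<Omega> s) (nehari \<Omega> s p q)"
    by (simp add: closure_on_def)
  show "(INF w\<in>nehari \<Omega> s p q. ereal (G_functional \<Omega> p q w)) \<le> 0"
  proof (rule ereal_le_epsilon2)
    fix \<epsilon> :: real assume "\<epsilon> > 0"
    then show "(INF w\<in>nehari \<Omega> s p q. ereal (G_functional \<Omega> p q w)) \<le> 0 + ereal \<epsilon>"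
    proof (rule small)
      fix w assume "w \<in> nehari \<Omega> s p q" "G_functional \<Omega> p q w < \<epsilon>"
      then show ?thesis by (intro INF_lower2[of w]) auto
    qed
  qed
qed

end
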